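(* Let $A$ be a commutative ring, let $\mathfrak{a}$ be a finitely generated ideal in $A$, and let $\{ M_k \}_{k \in \mathbb{N}}$ be an $\mathfrak{a}$-adic system of $A$-modules, with limit $\widehat{M} = \lim_{\leftarrow k} M_k$. Then: (1) The $A$-module $\widehat{M}$ is $\mathfrak{a}$-adically complete. (2) For every $k \geq 0$ the canonical homomorphism $A_k \otimes_A \widehat{M} \to M_k$ is bijective.
   Context: Here $\mathbb{N} = \{0,1,2,\ldots\}$ and $A_k := A/\mathfrak{a}^{k+1}$ for $k \in \mathbb{N}$. An $\mathfrak{a}$-adic system of $A$-modules is an inverse system $\{M_k\}_{k\in\mathbb{N}}$, where each $M_k$ is an $A_k$-module, with $A$-module homomorphisms (transitions) $\nu_k : M_{k+1} \to M_k$ such that for every $k$ the induced homomorphism $A_k \otimes_{A_{k+1}} M_{k+1} \to M_k$ is bijective. Its limit is the $A$-module $\lim_{\leftarrow k} M_k$. The canonical homomorphism $A_k \otimes_A \widehat{M} \to M_k$ is the one induced by the projection $\widehat{M} \to M_k$. For an $A$-module $N$, the $\mathfrak{a}$-adic completion is $\lim_{\leftarrow k} (A_k \otimes_A N)$, and $N$ is called $\mathfrak{a}$-adically complete if the canonical homomorphism $\tau_N : N \to \lim_{\leftarrow k} (A_k \otimes_A N)$ is an isomorphism (so complete includes separated). *)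

theory Defs
  imports "HOL-Algebra.Algebra" "HOL-Algebra.Free_Abelian_Groups"
begin

section \<open>Modules\<close>

definition module_hom ::
  "('r, 'x) ring_scheme \<Rightarrow> ('r, 'm, 'y) module_scheme \<Rightarrow> ('r, 'n, 'z) module_scheme \<Rightarrow> ('m \<Rightarrow> 'n) set"
  where "module_hom R M N =
    {h \<in> carrier M \<rightarrow> carrier N.
       (\<forall>x\<in>carrier M. \<forall>y\<in>carrier M. h (x \<oplus>\<^bsub>M\<^esub> y) = h x \<oplus>\<^bsub>N\<^esub> h y) \<and>
       (\<forall>r\<in>carrier R. \<forall>x\<in>carrier M. h (r \<odot>\<^bsub>M\<^esub> x) = r \<odot>\<^bsub>N\<^esub> h x)}"

definition module_iso ::
  "('r, 'x) ring_scheme \<Rightarrow> ('r, 'm, 'y) module_scheme \<Rightarrow> ('r, 'n, 'z) module_scheme \<Rightarrow> ('m \<Rightarrow> 'n) set"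
  where "module_iso R M N = {h \<in> module_hom R M N. bij_betw h (carrier M) (carrier N)}"

definition self_module :: "('r, 'x) ring_scheme \<Rightarrow> ('r, 'r) module"
  where "self_module R =
    \<lparr>carrier = carrier R, monoid.mult = monoid.mult R, one = \<one>\<^bsub>R\<^esub>,
     ring.zero = \<zero>\<^bsub>R\<^esub>, ring.add = ring.add R, smult = monoid.mult R\<rparr>"

definition restrict_scalars :: "('r \<Rightarrow> 's) \<Rightarrow> ('s, 'm, 'y) module_scheme \<Rightarrow> ('r, 'm) module"
  where "restrict_scalars f M =
    \<lparr>carrier = carrier M, monoid.mult = monoid.mult M, one = \<one>\<^bsub>M\<^esub>, ring.zero = \<zero>\<^bsub>M\<^esub>, ring.add = ring.add M,
     smult = (\<lambda>r. smult M (f r))\<rparr>"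

text \<open>The map on cosets induced by a function that is constant on each coset.\<close>

definition coset_lift :: "('a \<Rightarrow> 'b) \<Rightarrow> 'a set \<Rightarrow> 'b"
  where "coset_lift f C = the_elem (f ` C)"


section \<open>Tensor products\<close>

text \<open>The tensor product of two modules over a commutative ring \<open>R\<close> is the free abelian group on
  the pairs of elements, modulo the subgroup generated by the bilinearity and balancing relations;
  \<open>R\<close> acts by \<open>r (m \<otimes> n) = (r m) \<otimes> n\<close>. The \<open>mult\<close> and \<open>one\<close> fields, which the library's record of
  modules inherits from rings, carry no information for a module.\<close>

definition tensor_relations ::
  "('r, 'x) ring_scheme \<Rightarrow> ('r, 'm, 'y) module_scheme \<Rightarrow> ('r, 'n, 'z) module_scheme
    \<Rightarrow> ('m \<times> 'n \<Rightarrow>\<^sub>0 int) set"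
  where "tensor_relations R M N =
    {frag_of (m \<oplus>\<^bsub>M\<^esub> m', n) - frag_of (m, n) - frag_of (m', n) | m m' n.
       m \<in> carrier M \<and> m' \<in> carrier M \<and> n \<in> carrier N} \<union>
    {frag_of (m, n \<oplus>\<^bsub>N\<^esub> n') - frag_of (m, n) - frag_of (m, n') | m n n'.
       m \<in> carrier M \<and> n \<in> carrier N \<and> n' \<in> carrier N} \<union>
    {frag_of (r \<odot>\<^bsub>M\<^esub> m, n) - frag_of (m, r \<odot>\<^bsub>N\<^esub> n) | r m n.
       r \<in> carrier R \<and> m \<in> carrier M \<and> n \<in> carrier N}"

abbreviation tensor_free ::
  "('r, 'm, 'y) module_scheme \<Rightarrow> ('r, 'n, 'z) module_scheme \<Rightarrow> ('m \<times> 'n \<Rightarrow>\<^sub>0 int) monoid"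
  where "tensor_free M N \<equiv> free_Abelian_group (carrier M \<times> carrier N)"

definition tensor_subgroup ::
  "('r, 'x) ring_scheme \<Rightarrow> ('r, 'm, 'y) module_scheme \<Rightarrow> ('r, 'n, 'z) module_scheme
    \<Rightarrow> ('m \<times> 'n \<Rightarrow>\<^sub>0 int) set"
  where "tensor_subgroup R M N = generate (tensor_free M N) (tensor_relations R M N)"

definition tensor_class ::
  "('r, 'x) ring_scheme \<Rightarrow> ('r, 'm, 'y) module_scheme \<Rightarrow> ('r, 'n, 'z) module_scheme
    \<Rightarrow> ('m \<times> 'n \<Rightarrow>\<^sub>0 int) \<Rightarrow> ('m \<times> 'n \<Rightarrow>\<^sub>0 int) set"
  where "tensor_class R M N c = tensor_subgroup R M N #>\<^bsub>tensor_free M N\<^esub> c"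

definition tensor ::
  "('r, 'x) ring_scheme \<Rightarrow> ('r, 'm, 'y) module_scheme \<Rightarrow> ('r, 'n, 'z) module_scheme
    \<Rightarrow> ('r, ('m \<times> 'n \<Rightarrow>\<^sub>0 int) set) module"
  where "tensor R M N =
    (let T = tensor_free M N Mod tensor_subgroup R M N in
     \<lparr>carrier = carrier T, monoid.mult = undefined, one = undefined,
      ring.zero = \<one>\<^bsub>T\<^esub>, ring.add = monoid.mult T,
      smult = (\<lambda>r. coset_lift (\<lambda>c. tensor_class R M N
                (frag_extend (\<lambda>(m, n). frag_of (r \<odot>\<^bsub>M\<^esub> m, n)) c)))\<rparr>)"

definition pure_tensor ::
  "('r, 'x) ring_scheme \<Rightarrow> ('r, 'm, 'y) module_scheme \<Rightarrow> ('r, 'n, 'z) module_scheme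
    \<Rightarrow> 'm \<Rightarrow> 'n \<Rightarrow> ('m \<times> 'n \<Rightarrow>\<^sub>0 int) set"
  where "pure_tensor R M N m n = tensor_class R M N (frag_of (m, n))"

text \<open>The additive map \<open>m \<otimes> n \<mapsto> \<phi> m n\<close> into \<open>P\<close> induced by a balanced biadditive map \<open>\<phi>\<close>.\<close>

definition tensor_lift ::
  "('s, 'p, 'y) module_scheme \<Rightarrow> ('m \<Rightarrow> 'n \<Rightarrow> 'p) \<Rightarrow> ('m \<times> 'n \<Rightarrow>\<^sub>0 int) set \<Rightarrow> 'p"
  where "tensor_lift P \<phi> =
    coset_lift (\<lambda>c. \<Oplus>\<^bsub>P\<^esub>p\<in>Poly_Mapping.keys c.
      add_pow P (Poly_Mapping.lookup c p) (\<phi> (fst p) (snd p)))"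

text \<open>For a ring homomorphism \<open>R \<rightarrow> S\<close>, an \<open>S\<close>-module \<open>P\<close> and an \<open>R\<close>-linear map \<open>h: N \<rightarrow> P\<close>,
  the induced homomorphism \<open>S \<otimes>\<^sub>R N \<rightarrow> P\<close>, \<open>s \<otimes> n \<mapsto> s h(n)\<close>.\<close>

definition base_change_lift ::
  "('s, 'p, 'y) module_scheme \<Rightarrow> ('n \<Rightarrow> 'p) \<Rightarrow> ('s \<times> 'n \<Rightarrow>\<^sub>0 int) set \<Rightarrow> 'p"
  where "base_change_lift P h = tensor_lift P (\<lambda>s n. s \<odot>\<^bsub>P\<^esub> h n)"


section \<open>Inverse limits\<close>

definition inverse_limit ::
  "(nat \<Rightarrow> ('r, 'm, 'y) module_scheme) \<Rightarrow> (nat \<Rightarrow> 'm \<Rightarrow> 'm) \<Rightarrow> ('r, nat \<Rightarrow> 'm) module"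
  where "inverse_limit M \<nu> =
    \<lparr>carrier = {x. \<forall>k. x k \<in> carrier (M k) \<and> \<nu> k (x (Suc k)) = x k},
     monoid.mult = undefined, one = undefined,
     ring.zero = (\<lambda>k. \<zero>\<^bsub>M k\<^esub>),
     ring.add = (\<lambda>x y k. x k \<oplus>\<^bsub>M k\<^esub> y k),
     smult = (\<lambda>r x k. r \<odot>\<^bsub>M k\<^esub> x k)\<rparr>"


section \<open>Adic systems and adic completeness\<close>

definition adic_power :: "('a, 'x) ring_scheme \<Rightarrow> 'a set \<Rightarrow> nat \<Rightarrow> 'a set"
  where "adic_power A I k = I [^]\<^bsub>ideals_set A\<^esub> Suc k"

definition adic_ring :: "('a, 'x) ring_scheme \<Rightarrow> 'a set \<Rightarrow> nat \<Rightarrow> 'a set ring"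
  where "adic_ring A I k = A Quot adic_power A I k"

definition adic_proj :: "('a, 'x) ring_scheme \<Rightarrow> 'a set \<Rightarrow> nat \<Rightarrow> 'a \<Rightarrow> 'a set"
  where "adic_proj A I k a = adic_power A I k +>\<^bsub>A\<^esub> a"

text \<open>The canonical ring homomorphism from \<open>adic_ring A I (Suc k)\<close> to \<open>adic_ring A I k\<close>.\<close>

definition adic_trans :: "('a, 'x) ring_scheme \<Rightarrow> 'a set \<Rightarrow> nat \<Rightarrow> 'a set \<Rightarrow> 'a set"
  where "adic_trans A I k = coset_lift (adic_proj A I k)"

definition adic_algebra :: "('a, 'x) ring_scheme \<Rightarrow> 'a set \<Rightarrow> nat \<Rightarrow> ('a, 'a set) module"
  where "adic_algebra A I k = restrict_scalars (adic_proj A I k) (self_module (adic_ring A I k))"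

definition adic_system ::
  "('a, 'x) ring_scheme \<Rightarrow> 'a set \<Rightarrow> (nat \<Rightarrow> ('a set, 'm, 'y) module_scheme)
    \<Rightarrow> (nat \<Rightarrow> 'm \<Rightarrow> 'm) \<Rightarrow> bool"
  where "adic_system A I M \<nu> \<longleftrightarrow>
    (\<forall>k. module (adic_ring A I k) (M k)) \<and>
    (\<forall>k. \<nu> k \<in> module_hom A (restrict_scalars (adic_proj A I (Suc k)) (M (Suc k)))
                              (restrict_scalars (adic_proj A I k) (M k))) \<and>
    (\<forall>k. bij_betw (base_change_lift (M k) (\<nu> k))
           (carrier (tensor (adic_ring A I (Suc k))
              (restrict_scalars (adic_trans A I k) (self_module (adic_ring A I k)))
              (M (Suc k))))
           (carrier (M k)))"

definition adic_limit ::
  "('a, 'x) ring_scheme \<Rightarrow> 'a set \<Rightarrow> (nat \<Rightarrow> ('a set, 'm, 'y) module_scheme)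
    \<Rightarrow> (nat \<Rightarrow> 'm \<Rightarrow> 'm) \<Rightarrow> ('a, nat \<Rightarrow> 'm) module"
  where "adic_limit A I M \<nu> = inverse_limit (\<lambda>k. restrict_scalars (adic_proj A I k) (M k)) \<nu>"

abbreviation adic_reduction ::
  "('a, 'x) ring_scheme \<Rightarrow> 'a set \<Rightarrow> ('a, 'n, 'y) module_scheme \<Rightarrow> nat
    \<Rightarrow> ('a, ('a set \<times> 'n \<Rightarrow>\<^sub>0 int) set) module"
  where "adic_reduction A I N k \<equiv> tensor A (adic_algebra A I k) N"

text \<open>The transition maps of the reductions of \<open>N\<close> are \<open>s \<otimes> n \<mapsto> \<pi>(s) \<otimes> n\<close>, with \<open>\<pi>\<close> the
  transition map of the rings.\<close>

definition adic_completion ::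
  "('a, 'x) ring_scheme \<Rightarrow> 'a set \<Rightarrow> ('a, 'n, 'y) module_scheme
    \<Rightarrow> ('a, nat \<Rightarrow> ('a set \<times> 'n \<Rightarrow>\<^sub>0 int) set) module"
  where "adic_completion A I N =
    inverse_limit (adic_reduction A I N)
      (\<lambda>k. tensor_lift (adic_reduction A I N k)
        (\<lambda>s n. pure_tensor A (adic_algebra A I k) N (adic_trans A I k s) n))"

definition adic_tau ::
  "('a, 'x) ring_scheme \<Rightarrow> 'a set \<Rightarrow> ('a, 'n, 'y) module_scheme
    \<Rightarrow> 'n \<Rightarrow> nat \<Rightarrow> ('a set \<times> 'n \<Rightarrow>\<^sub>0 int) set"
  where "adic_tau A I N n =
    (\<lambda>k. pure_tensor A (adic_algebra A I k) N \<one>\<^bsub>adic_ring A I k\<^esub> n)"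

definition adically_complete ::
  "('a, 'x) ring_scheme \<Rightarrow> 'a set \<Rightarrow> ('a, 'n, 'y) module_scheme \<Rightarrow> bool"
  where "adically_complete A I N \<longleftrightarrow>
    module A N \<and> adic_tau A I N \<in> module_iso A N (adic_completion A I N)"

end

theory Submission
  imports Defs
begin

text \<open>
  Write \<open>P\<^sub>k\<close> for \<open>M\<^sub>k\<close> regarded as an \<open>A\<close>-module and \<open>N\<close> for the limit. Tensor products enter the
  statement only through a base change \<open>S \<otimes>\<^sub>R N\<close> along a \<^emph>\<open>surjective\<close> ring homomorphism \<open>\<pi>: R \<rightarrow> S\<close>. Such
  a module is \<open>N / (ker \<pi>) N\<close>: every element is of the form \<open>1 \<otimes> n\<close>, and \<open>1 \<otimes> n = 1 \<otimes> n'\<close> exactly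
  if \<open>n - n' \<in> (ker \<pi>) N\<close> (\<open>carrier_T\<close> and \<open>unit_tensor_eq_iff\<close> in \<open>surjective_base_change\<close>). So the map
  \<open>S \<otimes>\<^sub>R N \<rightarrow> P\<close> induced by \<open>h: N \<rightarrow> P\<close> is bijective exactly if \<open>h\<close> is onto with kernel inside
  \<open>(ker \<pi>) N\<close> (\<open>bij_betw_base_change_lift_iff\<close>). This turns everything into statements about
  submodules. An adic system becomes an \<open>adic_tower\<close>: the transitions are onto, with kernel in
  \<open>I\<^sup>k\<^sup>+\<^sup>1 P\<^sub>k\<^sub>+\<^sub>1\<close>, and \<open>I\<^sup>k\<^sup>+\<^sup>1\<close> kills \<open>P\<^sub>k\<close>. Part (2) says that \<open>N \<rightarrow> P\<^sub>k\<close> is onto, which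
  is clear, with kernel in \<open>I\<^sup>k\<^sup>+\<^sup>1 N\<close>.

  The kernel is the heart of the matter. Let \<open>F\<^sub>k\<close> be the submodule of those \<open>x \<in> N\<close> whose components below \<open>k\<close>
  vanish, so that \<open>F\<^sub>k\<^sub>+\<^sub>1\<close> is the kernel of \<open>N \<rightarrow> P\<^sub>k\<close>. The claim is \<open>F\<^sub>k\<^sub>+\<^sub>1 \<subseteq> I F\<^sub>k\<close>, and then
  \<open>F\<^sub>k \<subseteq> I\<^sup>k N\<close> follows by induction. Let \<open>g\<^sub>1, \<dots>, g\<^sub>m\<close> generate \<open>I\<close> and let \<open>x \<in> F\<^sub>k\<^sub>+\<^sub>1\<close>.
  If \<open>x\<close> and \<open>\<Sum> g\<^sub>i z\<^sub>i\<close> agree in the component \<open>n \<ge> k\<close>, their difference in the component \<open>n + 1\<close> is killed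
  by the transition, hence lies in \<open>I \<cdot> I\<^sup>n P\<^sub>n\<^sub>+\<^sub>1\<close> and is \<open>\<Sum> g\<^sub>i y\<^sub>i\<close> with \<open>y\<^sub>i \<in> I\<^sup>n P\<^sub>n\<^sub>+\<^sub>1\<close>. Adding lifts of
  the \<open>y\<^sub>i\<close> to the \<open>z\<^sub>i\<close> gives agreement in the component \<open>n + 1\<close>, and changes no component below \<open>n\<close>, because
  there \<open>I\<^sup>n\<close> acts as zero (\<open>approximation_step\<close>). Thus the components of the \<open>z\<^sub>i\<close> become stationary and define
  elements of \<open>N\<close> with \<open>x = \<Sum> g\<^sub>i z\<^sub>i\<close> (\<open>component_zero_imp_combination\<close>). Finite generation
  provides a number \<open>m\<close> of summands that does not grow with \<open>n\<close>, without which there would be no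
  sequences \<open>z\<^sub>i\<close> to pass to the limit with.

  Part (1) follows, since \<open>I\<^sup>k\<^sup>+\<^sup>1 N\<close> is now known to be the kernel of \<open>N \<rightarrow> P\<^sub>k\<close>: the adic topology
  of \<open>N\<close> is its topology as an inverse limit, in which \<open>N\<close> is separated and every Cauchy
  sequence converges to its diagonal (\<open>adically_complete_N\<close>).
\<close>

section \<open>Abelian groups and modules\<close>

lemma (in abelian_group) minus_eq_zero_iff:
  "\<lbrakk>x \<in> carrier G; y \<in> carrier G\<rbrakk> \<Longrightarrow> x \<ominus> y = \<zero> \<longleftrightarrow> x = y"
  by (metis a_minus_def add.inv_equality add.inv_closed minus_minus r_neg)

lemma (in abelian_group) minus_self [simp]: "x \<in> carrier G \<Longrightarrow> x \<ominus> x = \<zero>"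
  by (simp add: a_minus_def r_neg)

lemma (in abelian_group) minus_cancel:
  assumes "x \<in> carrier G" "y \<in> carrier G"
  shows "(x \<oplus> y) \<ominus> x = y" "x \<ominus> (x \<ominus> y) = y" "(x \<ominus> y) \<oplus> y = x"
proof -
  show 1: "(x \<ominus> y) \<oplus> y = x" using assms by (simp add: a_minus_def a_assoc l_neg)
  show "(x \<oplus> y) \<ominus> x = y" using assms by (simp add: a_minus_def a_comm[of x y] a_assoc r_neg)
  have "x \<ominus> (x \<ominus> y) = ((x \<ominus> y) \<oplus> y) \<ominus> (x \<ominus> y)" using 1 by simp
  also have "\<dots> = y" using assms by (simp add: a_minus_def a_comm[of _ y] a_assoc r_neg)
  finally show "x \<ominus> (x \<ominus> y) = y" .
qed

text \<open>Records that have the same additive structure as a commutative group inherit its laws. The equations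
are between fields, because \<^const>\<open>add_monoid\<close> carries along the scalar multiplication of a module.\<close>

lemma abelian_group_of_comm_group:
  assumes "comm_group T" "carrier P = carrier T" "ring.add P = monoid.mult T" "\<zero>\<^bsub>P\<^esub> = \<one>\<^bsub>T\<^esub>"
  shows "abelian_group P"
proof -
  interpret comm_group T by fact
  show ?thesis
    by (rule abelian_groupI) (auto simp: assms m_ac intro: l_inv_ex)
qed

lemma (in group_hom) subgroup_preimage:
  assumes "subgroup K H"
  shows "subgroup {x \<in> carrier G. h x \<in> K} G"
proof -
  interpret K: subgroup K H by fact
  show ?thesis
    by (rule G.subgroupI) (use K.one_closed K.m_closed K.m_inv_closed in \<open>auto intro!: exI[of _ "\<one>\<^bsub>G\<^esub>"]\<close>)
qed

lemma module_restrict_scalars: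
  assumes R: "cring R" and \<pi>: "\<pi> \<in> ring_hom R S" and M: "module S M"
  shows "module R (restrict_scalars \<pi> M)"
proof -
  interpret M: module S M by fact
  have eqs: "carrier (restrict_scalars \<pi> M) = carrier M" "ring.add (restrict_scalars \<pi> M) = ring.add M"
    "\<zero>\<^bsub>restrict_scalars \<pi> M\<^esub> = \<zero>\<^bsub>M\<^esub>" "\<And>r x. r \<odot>\<^bsub>restrict_scalars \<pi> M\<^esub> x = \<pi> r \<odot>\<^bsub>M\<^esub> x"
    by (simp_all add: restrict_scalars_def)
  have "abelian_group (restrict_scalars \<pi> M)"
    by (rule abelian_group_of_comm_group[OF M.a_comm_group]) (simp_all add: eqs)
  moreover have "\<one>\<^bsub>S\<^esub> \<odot>\<^bsub>M\<^esub> x = x" if "x \<in> carrier M" for x using that by (rule M.smult_one)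
  ultimately show ?thesis
    by (intro moduleI[OF R])
      (simp_all only: eqs ring_hom_closed[OF \<pi>] ring_hom_add[OF \<pi>] ring_hom_mult[OF \<pi>] ring_hom_one[OF \<pi>]
        M.smult_closed M.smult_l_distr M.smult_r_distr M.smult_assoc1)
qed

lemma module_self_module:
  assumes "cring S" shows "module S (self_module S)"
proof -
  interpret cring S by fact
  have "abelian_group (self_module S)"
    by (rule abelian_group_of_comm_group[OF a_comm_group]) (simp_all add: self_module_def)
  then show ?thesis
    by (rule moduleI[OF assms]) (simp_all add: self_module_def l_distr r_distr m_assoc)
qed

lemma module_homD:
  assumes "f \<in> module_hom R M N"
  shows "x \<in> carrier M \<Longrightarrow> f x \<in> carrier N"
    "\<lbrakk>x \<in> carrier M; y \<in> carrier M\<rbrakk> \<Longrightarrow> f (x \<oplus>\<^bsub>M\<^esub> y) = f x \<oplus>\<^bsub>N\<^esub> f y"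
    "\<lbrakk>r \<in> carrier R; x \<in> carrier M\<rbrakk> \<Longrightarrow> f (r \<odot>\<^bsub>M\<^esub> x) = r \<odot>\<^bsub>N\<^esub> f x"
  using assms unfolding module_hom_def by auto

lemma module_hom_group_hom:
  assumes M: "module R M" and N: "module R N" and f: "f \<in> module_hom R M N"
  shows "group_hom (add_monoid M) (add_monoid N) f"
proof -
  interpret M: module R M by fact
  interpret N: module R N by fact
  show ?thesis
    using module_homD[OF f] M.M.a_group N.M.a_group
    by (auto simp: group_hom_def group_hom_axioms_def hom_def)
qed

lemma module_hom_zero:
  assumes "module R M" "module R N" "f \<in> module_hom R M N"
  shows "f \<zero>\<^bsub>M\<^esub> = \<zero>\<^bsub>N\<^esub>"
  using group_hom.hom_one[OF module_hom_group_hom[OF assms]] by simp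

lemma module_hom_minus:
  assumes M: "module R M" and N: "module R N" and f: "f \<in> module_hom R M N"
    and xy: "x \<in> carrier M" "y \<in> carrier M"
  shows "f (x \<ominus>\<^bsub>M\<^esub> y) = f x \<ominus>\<^bsub>N\<^esub> f y"
proof -
  interpret M: module R M by fact
  have "f (\<ominus>\<^bsub>M\<^esub> y) = \<ominus>\<^bsub>N\<^esub> f y"
    using group_hom.hom_inv[OF module_hom_group_hom[OF M N f], of y] xy by (simp add: a_inv_def)
  then show ?thesis using xy by (simp add: a_minus_def module_homD[OF f])
qed

lemma module_hom_finsum:
  assumes M: "module R M" and N: "module R N" and f: "f \<in> module_hom R M N"
    and S: "finite S" "\<And>s. s \<in> S \<Longrightarrow> x s \<in> carrier M"
  shows "f (\<Oplus>\<^bsub>M\<^esub>s\<in>S. x s) = (\<Oplus>\<^bsub>N\<^esub>s\<in>S. f (x s))"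
proof -
  interpret M: module R M by fact
  interpret N: module R N by fact
  from S show ?thesis
  proof (induction S)
    case empty
    then show ?case by (simp add: module_hom_zero[OF M N f])
  next
    case (insert s S)
    have "(\<Oplus>\<^bsub>M\<^esub>s\<in>S. x s) \<in> carrier M" using insert by (auto intro!: M.M.finsum_closed)
    then show ?case
      using insert by (simp add: Pi_iff module_homD[OF f])
  qed
qed

section \<open>Tensor products\<close>

text \<open>The homomorphism on formal sums that extends \<^term>\<open>f\<close>: \<^const>\<open>tensor_lift\<close> is by definition the map that it
induces on cosets.\<close>

definition frag_sum :: "('p, 'y) ring_scheme \<Rightarrow> ('a \<Rightarrow> 'p) \<Rightarrow> ('a \<Rightarrow>\<^sub>0 int) \<Rightarrow> 'p"
  where "frag_sum P f c = (\<Oplus>\<^bsub>P\<^esub>p\<in>Poly_Mapping.keys c. add_pow P (Poly_Mapping.lookup c p) (f p))"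

lemma (in abelian_group) frag_sum_superset:
  assumes "f \<in> B \<rightarrow> carrier G" "Poly_Mapping.keys c \<subseteq> Y" "Y \<subseteq> B" "finite Y"
  shows "frag_sum G f c = (\<Oplus>p\<in>Y. add_pow G (Poly_Mapping.lookup c p) (f p))"
  unfolding frag_sum_def
  by (rule add.finprod_mono_neutral_cong_left)
    (use assms in \<open>auto simp: Pi_iff in_keys_iff add_pow_def[of _ 0]\<close>)

lemma (in abelian_group) frag_sum_hom:
  assumes f: "f \<in> B \<rightarrow> carrier G"
  shows "frag_sum G f \<in> hom (free_Abelian_group B) (add_monoid G)"
proof (rule homI)
  fix c assume "c \<in> carrier (free_Abelian_group B)"
  then show "frag_sum G f c \<in> carrier (add_monoid G)"
    using f unfolding frag_sum_def by (auto intro!: finsum_closed)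
next
  fix c d assume cd: "c \<in> carrier (free_Abelian_group B)" "d \<in> carrier (free_Abelian_group B)"
  let ?Y = "Poly_Mapping.keys c \<union> Poly_Mapping.keys d"
  have Y: "?Y \<subseteq> B" "finite ?Y" using cd by auto
  have eval: "frag_sum G f e = (\<Oplus>p\<in>?Y. add_pow G (Poly_Mapping.lookup e p) (f p))"
    if "Poly_Mapping.keys e \<subseteq> ?Y" for e
    by (rule frag_sum_superset[OF f that Y])
  have fY: "f p \<in> carrier G" if "p \<in> ?Y" for p using f Y that by auto
  have "frag_sum G f (c + d)
      = (\<Oplus>p\<in>?Y. add_pow G (Poly_Mapping.lookup c p) (f p) \<oplus> add_pow G (Poly_Mapping.lookup d p) (f p))"
    unfolding eval[OF keys_add]
    by (rule finsum_cong') (use fY in \<open>auto simp: lookup_add add.int_pow_mult\<close>)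
  also have "\<dots> = frag_sum G f c \<oplus> frag_sum G f d"
    using fY by (subst finsum_addf) (auto simp: eval)
  finally show "frag_sum G f (c \<otimes>\<^bsub>free_Abelian_group B\<^esub> d)
      = frag_sum G f c \<otimes>\<^bsub>add_monoid G\<^esub> frag_sum G f d" by simp
qed

lemma (in abelian_group) frag_sum_frag_of:
  assumes "f a \<in> carrier G"
  shows "frag_sum G f (frag_of a) = f a"
  using assms by (simp add: frag_sum_def keys_frag_of finsum_insert)

lemma (in abelian_group) frag_sum_diff:
  assumes f: "f \<in> B \<rightarrow> carrier G" and cd: "Poly_Mapping.keys c \<subseteq> B" "Poly_Mapping.keys d \<subseteq> B"
  shows "frag_sum G f (c - d) = frag_sum G f c \<ominus> frag_sum G f d"
proof -
  interpret h: group_hom "free_Abelian_group B" "add_monoid G" "frag_sum G f"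
    using frag_sum_hom[OF f] by (simp add: group_hom_def group_hom_axioms_def add.is_group)
  have "frag_sum G f (c + - d) = frag_sum G f c \<oplus> frag_sum G f (- d)"
    using h.hom_mult[of c "- d"] cd by simp
  moreover have "frag_sum G f (- d) = \<ominus> frag_sum G f d"
    using h.hom_inv[of d] cd by (simp add: a_inv_def)
  ultimately show ?thesis by (simp add: a_minus_def)
qed

lemma tensor_relations_subset:
  assumes "module R M" "module R N"
  shows "tensor_relations R M N \<subseteq> carrier (tensor_free M N)"
proof -
  interpret M: module R M by fact
  interpret N: module R N by fact
  show ?thesis unfolding tensor_relations_def
    by (auto simp: keys_frag_of dest!: subsetD[OF keys_diff])
qed

lemma subgroup_tensor_subgroup:
  assumes "module R M" "module R N"
  shows "subgroup (tensor_subgroup R M N) (tensor_free M N)"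
  unfolding tensor_subgroup_def
  by (rule group.generate_is_subgroup[OF group_free_Abelian_group tensor_relations_subset[OF assms]])

lemma normal_tensor_subgroup:
  assumes "module R M" "module R N"
  shows "tensor_subgroup R M N \<lhd> tensor_free M N"
  by (rule comm_group.subgroup_imp_normal[OF abelian_free_Abelian_group subgroup_tensor_subgroup[OF assms]])

lemma abelian_group_tensor:
  assumes "module R M" "module R N"
  shows "abelian_group (tensor R M N)"
proof -
  have "comm_group (tensor_free M N Mod tensor_subgroup R M N)"
    by (rule comm_group.abelian_FactGroup[OF abelian_free_Abelian_group subgroup_tensor_subgroup[OF assms]])
  then show ?thesis
    by (rule abelian_group_of_comm_group) (simp_all add: tensor_def Let_def)
qed

lemma tensor_class_eq_iff:
  assumes "module R M" "module R N" "c \<in> carrier (tensor_free M N)" "d \<in> carrier (tensor_free M N)"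
  shows "tensor_class R M N c = tensor_class R M N d \<longleftrightarrow> c - d \<in> tensor_subgroup R M N"
proof -
  interpret L: subgroup "tensor_subgroup R M N" "tensor_free M N"
    by (rule subgroup_tensor_subgroup[OF assms(1,2)])
  have "c - d \<in> tensor_subgroup R M N \<longleftrightarrow> c \<in> tensor_class R M N d"
    unfolding tensor_class_def r_coset_def by (auto intro!: bexI[of _ "c - d"])
  moreover have "c \<in> tensor_class R M N d \<longleftrightarrow> tensor_class R M N c = tensor_class R M N d"
    unfolding tensor_class_def
    by (metis assms(3,4) group.repr_independence group.rcos_self group_free_Abelian_group L.subgroup_axioms)
  ultimately show ?thesis by blast
qed

lemma carrier_tensor: "carrier (tensor R M N) = tensor_class R M N ` carrier (tensor_free M N)"
  by (auto simp: tensor_def Let_def FactGroup_def RCOSETS_def tensor_class_def)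

lemma tensor_add_class:
  assumes "module R M" "module R N" "c \<in> carrier (tensor_free M N)" "d \<in> carrier (tensor_free M N)"
  shows "tensor_class R M N c \<oplus>\<^bsub>tensor R M N\<^esub> tensor_class R M N d = tensor_class R M N (c + d)"
  using normal.rcos_sum[OF normal_tensor_subgroup[OF assms(1,2)] assms(3,4)]
  by (simp add: tensor_def Let_def FactGroup_def tensor_class_def)

text \<open>The only way in which maps out of a tensor product are evaluated: on representatives, once the value is
known to be the same for all of them.\<close>

lemma coset_lift_tensor_class:
  assumes "module R M" "module R N" "c \<in> carrier (tensor_free M N)"
    and "\<And>d. d \<in> carrier (tensor_free M N) \<Longrightarrow> c - d \<in> tensor_subgroup R M N \<Longrightarrow> f d = f c"
  shows "coset_lift f (tensor_class R M N c) = f c"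
proof -
  interpret L: subgroup "tensor_subgroup R M N" "tensor_free M N"
    by (rule subgroup_tensor_subgroup[OF assms(1,2)])
  have self: "c \<in> tensor_class R M N c"
    unfolding tensor_class_def
    by (rule group.rcos_self[OF group_free_Abelian_group assms(3) L.subgroup_axioms])
  have "f d = f c" if d: "d \<in> tensor_class R M N c" for d
  proof (rule assms(4))
    show dc: "d \<in> carrier (tensor_free M N)"
      using d L.subset assms(3) monoid.r_coset_subset_G[OF group.is_monoid[OF group_free_Abelian_group]]
      unfolding tensor_class_def by blast
    have "tensor_class R M N c = tensor_class R M N d"
      using d assms(3) L.subgroup_axioms unfolding tensor_class_def
      by (metis group.repr_independence group_free_Abelian_group)
    then show "c - d \<in> tensor_subgroup R M N"
      using tensor_class_eq_iff[OF assms(1-3) dc] by blast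
  qed
  then have "f ` tensor_class R M N c = {f c}" using self by blast
  then show ?thesis by (simp add: coset_lift_def)
qed

text \<open>The bilinearity and balancing relations hold for \<^term>\<open>\<phi>\<close> modulo a subgroup \<^term>\<open>H\<close> of the target. With
\<^term>\<open>H\<close> trivial this is the hypothesis of the universal property; a larger \<^term>\<open>H\<close> gives maps to the
quotient by \<^term>\<open>H\<close> without forming that quotient.\<close>

definition balanced_mod ::
  "('r, 'x) ring_scheme \<Rightarrow> ('r, 'm, 'y) module_scheme \<Rightarrow> ('r, 'n, 'z) module_scheme
    \<Rightarrow> ('p, 'w) ring_scheme \<Rightarrow> 'p set \<Rightarrow> ('m \<Rightarrow> 'n \<Rightarrow> 'p) \<Rightarrow> bool"
  where "balanced_mod R M N P H \<phi> \<longleftrightarrow>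
    (\<forall>m\<in>carrier M. \<forall>n\<in>carrier N. \<phi> m n \<in> carrier P) \<and>
    (\<forall>m\<in>carrier M. \<forall>m'\<in>carrier M. \<forall>n\<in>carrier N.
       \<phi> (m \<oplus>\<^bsub>M\<^esub> m') n \<ominus>\<^bsub>P\<^esub> \<phi> m n \<ominus>\<^bsub>P\<^esub> \<phi> m' n \<in> H) \<and>
    (\<forall>m\<in>carrier M. \<forall>n\<in>carrier N. \<forall>n'\<in>carrier N.
       \<phi> m (n \<oplus>\<^bsub>N\<^esub> n') \<ominus>\<^bsub>P\<^esub> \<phi> m n \<ominus>\<^bsub>P\<^esub> \<phi> m n' \<in> H) \<and>
    (\<forall>r\<in>carrier R. \<forall>m\<in>carrier M. \<forall>n\<in>carrier N.
       \<phi> (r \<odot>\<^bsub>M\<^esub> m) n \<ominus>\<^bsub>P\<^esub> \<phi> m (r \<odot>\<^bsub>N\<^esub> n) \<in> H)"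

text \<open>The formal sums that are sent to \<^term>\<open>H\<close> form a subgroup, and it contains all generators of the tensor relations.\<close>

lemma frag_sum_tensor_subgroup:
  assumes M: "module R M" and N: "module R N" and P: "abelian_group P"
    and H: "subgroup H (add_monoid P)" and \<phi>: "balanced_mod R M N P H \<phi>"
    and c: "c \<in> tensor_subgroup R M N"
  shows "frag_sum P (\<lambda>p. \<phi> (fst p) (snd p)) c \<in> H"
proof -
  interpret M: module R M by fact
  interpret N: module R N by fact
  interpret P: abelian_group P by fact
  interpret H: subgroup H "add_monoid P" by fact
  let ?B = "carrier M \<times> carrier N"
  let ?f = "\<lambda>p. \<phi> (fst p) (snd p)"
  have f: "?f \<in> ?B \<rightarrow> carrier P" using \<phi> by (auto simp: balanced_mod_def)
  interpret h: group_hom "tensor_free M N" "add_monoid P" "frag_sum P ?f"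
    using P.frag_sum_hom[OF f] by (simp add: group_hom_def group_hom_axioms_def P.add.is_group)
  note fd = P.frag_sum_diff[OF f]
  have keys: "Poly_Mapping.keys (frag_of p) \<subseteq> ?B \<longleftrightarrow> p \<in> ?B" for p by (simp add: keys_frag_of)
  have keysd: "Poly_Mapping.keys (frag_of p - frag_of q) \<subseteq> ?B" if "p \<in> ?B" "q \<in> ?B" for p q
    using keys_diff[of "frag_of p" "frag_of q"] that by (auto simp: keys_frag_of)
  have fo: "frag_sum P ?f (frag_of p) = ?f p" if "p \<in> ?B" for p
    by (rule P.frag_sum_frag_of) (use f that in auto)
  have rel: "frag_sum P ?f r \<in> H" if "r \<in> tensor_relations R M N" for r
  proof -
    from that \<phi> show ?thesis
      unfolding tensor_relations_def balanced_mod_def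
      by (auto simp: fd keys keysd fo)
  qed
  have sub: "tensor_relations R M N \<subseteq> carrier (tensor_free M N)"
    by (rule tensor_relations_subset[OF M N])
  from c show ?thesis unfolding tensor_subgroup_def
  proof (induction rule: generate.induct)
    case one then show ?case using h.hom_one H.one_closed by simp
  next
    case (incl r) then show ?case by (rule rel)
  next
    case (inv r)
    then show ?case using rel[OF inv] H.m_inv_closed h.hom_inv[of r] sub by auto
  next
    case (eng a b)
    have "a \<in> carrier (tensor_free M N)" "b \<in> carrier (tensor_free M N)"
      using eng group.generate_in_carrier[OF group_free_Abelian_group sub] by blast+
    then show ?case using eng h.hom_mult H.m_closed by fastforce
  qed
qed

lemma tensor_lift_class:
  assumes M: "module R M" and N: "module R N" and P: "abelian_group P"
    and \<phi>: "balanced_mod R M N P {\<zero>\<^bsub>P\<^esub>} \<phi>"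
    and c: "c \<in> carrier (tensor_free M N)"
  shows "tensor_lift P \<phi> (tensor_class R M N c) = frag_sum P (\<lambda>p. \<phi> (fst p) (snd p)) c"
proof -
  interpret P: abelian_group P by fact
  have f: "(\<lambda>p. \<phi> (fst p) (snd p)) \<in> carrier M \<times> carrier N \<rightarrow> carrier P"
    using \<phi> by (auto simp: balanced_mod_def)
  have z: "subgroup {\<zero>\<^bsub>P\<^esub>} (add_monoid P)"
    using P.add.triv_subgroup by simp
  note cl = hom_in_carrier[OF P.frag_sum_hom[OF f]]
  show ?thesis
    unfolding tensor_lift_def frag_sum_def[symmetric]
  proof (rule coset_lift_tensor_class[OF M N c])
    fix d assume d: "d \<in> carrier (tensor_free M N)" and "c - d \<in> tensor_subgroup R M N"
    then have "frag_sum P (\<lambda>p. \<phi> (fst p) (snd p)) (c - d) = \<zero>\<^bsub>P\<^esub>"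
      using frag_sum_tensor_subgroup[OF M N P z \<phi>] by blast
    then show "frag_sum P (\<lambda>p. \<phi> (fst p) (snd p)) d = frag_sum P (\<lambda>p. \<phi> (fst p) (snd p)) c"
      using P.frag_sum_diff[OF f, of c d] c d cl[OF c] cl[OF d] P.minus_eq_zero_iff by fastforce
  qed
qed

lemma tensor_lift_pure_tensor:
  assumes M: "module R M" and N: "module R N" and P: "abelian_group P"
    and \<phi>: "balanced_mod R M N P {\<zero>\<^bsub>P\<^esub>} \<phi>"
    and mn: "m \<in> carrier M" "n \<in> carrier N"
  shows "tensor_lift P \<phi> (pure_tensor R M N m n) = \<phi> m n"
  using tensor_lift_class[OF M N P \<phi>, of "frag_of (m, n)"] mn \<phi>
  by (simp add: pure_tensor_def keys_frag_of abelian_group.frag_sum_frag_of[OF P] balanced_mod_def)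

lemma pure_tensor_closed:
  "\<lbrakk>m \<in> carrier M; n \<in> carrier N\<rbrakk> \<Longrightarrow> pure_tensor R M N m n \<in> carrier (tensor R M N)"
  by (auto simp: carrier_tensor pure_tensor_def keys_frag_of)

lemma tensor_relationsI:
  "\<lbrakk>m \<in> carrier M; m' \<in> carrier M; n \<in> carrier N\<rbrakk>
    \<Longrightarrow> frag_of (m \<oplus>\<^bsub>M\<^esub> m', n) - frag_of (m, n) - frag_of (m', n) \<in> tensor_relations R M N"
  "\<lbrakk>m \<in> carrier M; n \<in> carrier N; n' \<in> carrier N\<rbrakk>
    \<Longrightarrow> frag_of (m, n \<oplus>\<^bsub>N\<^esub> n') - frag_of (m, n) - frag_of (m, n') \<in> tensor_relations R M N"
  "\<lbrakk>r \<in> carrier R; m \<in> carrier M; n \<in> carrier N\<rbrakk>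
    \<Longrightarrow> frag_of (r \<odot>\<^bsub>M\<^esub> m, n) - frag_of (m, r \<odot>\<^bsub>N\<^esub> n) \<in> tensor_relations R M N"
  unfolding tensor_relations_def by blast+

lemma tensor_class_eqI:
  assumes "module R M" "module R N" "c \<in> carrier (tensor_free M N)" "d \<in> carrier (tensor_free M N)"
    and "c - d \<in> tensor_relations R M N"
  shows "tensor_class R M N c = tensor_class R M N d"
  using assms by (simp only: tensor_class_eq_iff) (simp add: tensor_subgroup_def generate.incl)

lemma pure_tensor_add_left:
  assumes M: "module R M" and N: "module R N"
    and el: "m \<in> carrier M" "m' \<in> carrier M" "n \<in> carrier N"
  shows "pure_tensor R M N (m \<oplus>\<^bsub>M\<^esub> m') n
    = pure_tensor R M N m n \<oplus>\<^bsub>tensor R M N\<^esub> pure_tensor R M N m' n"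
proof -
  interpret M: module R M by fact
  interpret N: module R N by fact
  have k: "frag_of (m, n) + frag_of (m', n) \<in> carrier (tensor_free M N)"
    using keys_add[of "frag_of (m, n)" "frag_of (m', n)"] el by auto
  have "tensor_class R M N (frag_of (m \<oplus>\<^bsub>M\<^esub> m', n))
      = tensor_class R M N (frag_of (m, n) + frag_of (m', n))"
    by (rule tensor_class_eqI[OF M N _ k])
      (use el in \<open>simp, simp only: diff_diff_eq[symmetric] tensor_relationsI\<close>)
  then show ?thesis using el by (simp add: pure_tensor_def tensor_add_class[OF M N])
qed

lemma pure_tensor_add_right:
  assumes M: "module R M" and N: "module R N"
    and el: "m \<in> carrier M" "n \<in> carrier N" "n' \<in> carrier N"
  shows "pure_tensor R M N m (n \<oplus>\<^bsub>N\<^esub> n')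
    = pure_tensor R M N m n \<oplus>\<^bsub>tensor R M N\<^esub> pure_tensor R M N m n'"
proof -
  interpret M: module R M by fact
  interpret N: module R N by fact
  have k: "frag_of (m, n) + frag_of (m, n') \<in> carrier (tensor_free M N)"
    using keys_add[of "frag_of (m, n)" "frag_of (m, n')"] el by auto
  have "tensor_class R M N (frag_of (m, n \<oplus>\<^bsub>N\<^esub> n'))
      = tensor_class R M N (frag_of (m, n) + frag_of (m, n'))"
    by (rule tensor_class_eqI[OF M N _ k])
      (use el in \<open>simp, simp only: diff_diff_eq[symmetric] tensor_relationsI\<close>)
  then show ?thesis using el by (simp add: pure_tensor_def tensor_add_class[OF M N])
qed

lemma pure_tensor_balanced:
  assumes M: "module R M" and N: "module R N"
    and el: "r \<in> carrier R" "m \<in> carrier M" "n \<in> carrier N"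
  shows "pure_tensor R M N (r \<odot>\<^bsub>M\<^esub> m) n = pure_tensor R M N m (r \<odot>\<^bsub>N\<^esub> n)"
proof -
  interpret M: module R M by fact
  interpret N: module R N by fact
  show ?thesis unfolding pure_tensor_def
    by (rule tensor_class_eqI[OF M N])
      (use el in \<open>simp_all add: tensor_relationsI\<close>)
qed

text \<open>Scaling the first factor by \<^term>\<open>r\<close> turns each relation into another relation of the same kind, so the scalar
multiplication of the tensor product does not depend on representatives.\<close>

lemma frag_extend_smult_tensor_subgroup:
  fixes M :: "('r, 'm, 'y) module_scheme" and N :: "('r, 'n, 'z) module_scheme"
  assumes M: "module R M" and N: "module R N" and r: "r \<in> carrier R"
    and c: "c \<in> tensor_subgroup R M N"
  shows "frag_extend (\<lambda>(m, n). frag_of (r \<odot>\<^bsub>M\<^esub> m, n)) c \<in> tensor_subgroup R M N"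
proof -
  interpret M: module R M by fact
  interpret N: module R N by fact
  let ?g = "frag_extend (\<lambda>(m, n). frag_of (r \<odot>\<^bsub>M\<^esub> m, n)) :: ('m \<times> 'n \<Rightarrow>\<^sub>0 int) \<Rightarrow> _"
  have sub: "tensor_relations R M N \<subseteq> carrier (tensor_free M N)"
    by (rule tensor_relations_subset[OF M N])
  have rel: "?g c \<in> tensor_relations R M N" if "c \<in> tensor_relations R M N" for c
  proof -
    from that consider
      (l) m m' n where "c = frag_of (m \<oplus>\<^bsub>M\<^esub> m', n) - frag_of (m, n) - frag_of (m', n)"
        "m \<in> carrier M" "m' \<in> carrier M" "n \<in> carrier N"
    | (r) m n n' where "c = frag_of (m, n \<oplus>\<^bsub>N\<^esub> n') - frag_of (m, n) - frag_of (m, n')"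
        "m \<in> carrier M" "n \<in> carrier N" "n' \<in> carrier N"
    | (b) s m n where "c = frag_of (s \<odot>\<^bsub>M\<^esub> m, n) - frag_of (m, s \<odot>\<^bsub>N\<^esub> n)"
        "s \<in> carrier R" "m \<in> carrier M" "n \<in> carrier N"
      unfolding tensor_relations_def by blast
    then show ?thesis
    proof cases
      case l
      then have "?g c = frag_of (r \<odot>\<^bsub>M\<^esub> m \<oplus>\<^bsub>M\<^esub> r \<odot>\<^bsub>M\<^esub> m', n) - frag_of (r \<odot>\<^bsub>M\<^esub> m, n) - frag_of (r \<odot>\<^bsub>M\<^esub> m', n)"
        using r by (simp add: frag_extend_diff M.smult_r_distr)
      then show ?thesis using l r by (simp only: tensor_relationsI M.smult_closed)
    next
      case b
      have "r \<odot>\<^bsub>M\<^esub> (s \<odot>\<^bsub>M\<^esub> m) = s \<odot>\<^bsub>M\<^esub> (r \<odot>\<^bsub>M\<^esub> m)"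
        using b r by (metis M.R.m_comm M.smult_assoc1)
      then have "?g c = frag_of (s \<odot>\<^bsub>M\<^esub> (r \<odot>\<^bsub>M\<^esub> m), n) - frag_of (r \<odot>\<^bsub>M\<^esub> m, s \<odot>\<^bsub>N\<^esub> n)"
        using b r by (simp add: frag_extend_diff)
      then show ?thesis using b r by (simp only: tensor_relationsI M.smult_closed)
    next
      case r': r
      then have "?g c = frag_of (r \<odot>\<^bsub>M\<^esub> m, n \<oplus>\<^bsub>N\<^esub> n') - frag_of (r \<odot>\<^bsub>M\<^esub> m, n) - frag_of (r \<odot>\<^bsub>M\<^esub> m, n')"
        by (simp add: frag_extend_diff)
      then show ?thesis using r' r by (simp only: tensor_relationsI M.smult_closed)
    qed
  qed
  from c show ?thesis unfolding tensor_subgroup_def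
  proof (induction rule: generate.induct)
    case one then show ?case by (simp add: generate.one[of "tensor_free M N", simplified])
  next
    case (incl c) then show ?case by (rule generate.incl[OF rel])
  next
    case (inv c)
    have "inv\<^bsub>tensor_free M N\<^esub> c = - c" "inv\<^bsub>tensor_free M N\<^esub> (?g c) = - ?g c"
      using subsetD[OF sub inv] subsetD[OF sub rel[OF inv]] by (simp_all only: carrier_free_Abelian_group_iff inv_free_Abelian_group)
    then show ?case using generate.inv[OF rel[OF inv], of "tensor_free M N"] by (simp add: frag_extend_minus)
  next
    case (eng a b)
    then show ?case using generate.eng[of "?g a" "tensor_free M N" _ "?g b"] by (simp add: frag_extend_add)
  qed
qed

lemma tensor_smult_pure_tensor:
  fixes M :: "('r, 'm, 'y) module_scheme" and N :: "('r, 'n, 'z) module_scheme"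
  assumes M: "module R M" and N: "module R N"
    and el: "r \<in> carrier R" "m \<in> carrier M" "n \<in> carrier N"
  shows "r \<odot>\<^bsub>tensor R M N\<^esub> pure_tensor R M N m n = pure_tensor R M N (r \<odot>\<^bsub>M\<^esub> m) n"
proof -
  interpret M: module R M by fact
  let ?g = "frag_extend (\<lambda>(m, n). frag_of (r \<odot>\<^bsub>M\<^esub> m, n)) :: ('m \<times> 'n \<Rightarrow>\<^sub>0 int) \<Rightarrow> _"
  have cl: "?g c \<in> carrier (tensor_free M N)" if "c \<in> carrier (tensor_free M N)" for c
    using keys_frag_extend[of "\<lambda>(m, n). frag_of (r \<odot>\<^bsub>M\<^esub> m, n)" c] that el(1)
    by (fastforce simp: keys_frag_of)
  have "coset_lift (\<lambda>c. tensor_class R M N (?g c)) (tensor_class R M N (frag_of (m, n)))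
      = tensor_class R M N (?g (frag_of (m, n)))"
  proof (rule coset_lift_tensor_class[OF M N])
    show c: "frag_of (m, n) \<in> carrier (tensor_free M N)" using el by simp
    fix d assume d: "d \<in> carrier (tensor_free M N)" "frag_of (m, n) - d \<in> tensor_subgroup R M N"
    have "?g (frag_of (m, n)) - ?g d \<in> tensor_subgroup R M N"
      using frag_extend_smult_tensor_subgroup[OF M N el(1) d(2)] by (simp add: frag_extend_diff)
    then show "tensor_class R M N (?g d) = tensor_class R M N (?g (frag_of (m, n)))"
      using tensor_class_eq_iff[OF M N cl[OF c] cl[OF d(1)]] by simp
  qed
  then show ?thesis by (simp add: tensor_def Let_def pure_tensor_def)
qed

section \<open>The submodule spanned by an ideal\<close>

text \<open>For an ideal \<^term>\<open>J\<close> this is the submodule \<open>J N\<close>; an additive span suffices, as the products already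
absorb scalars.\<close>

definition smult_span :: "('r, 'n, 'z) module_scheme \<Rightarrow> 'r set \<Rightarrow> 'n set"
  where "smult_span N J = generate (add_monoid N) {j \<odot>\<^bsub>N\<^esub> n | j n. j \<in> J \<and> n \<in> carrier N}"

lemma (in module) subgroup_smult_span:
  "J \<subseteq> carrier R \<Longrightarrow> subgroup (smult_span M J) (add_monoid M)"
  unfolding smult_span_def
  by (rule group.generate_is_subgroup[OF M.a_group]) fastforce

lemma smult_span_incl: "\<lbrakk>j \<in> J; n \<in> carrier N\<rbrakk> \<Longrightarrow> j \<odot>\<^bsub>N\<^esub> n \<in> smult_span N J"
  unfolding smult_span_def by (auto intro: generate.incl)

lemma (in module) smult_span_subset_subgroup:
  assumes H: "subgroup H (add_monoid M)" and "\<And>j n. \<lbrakk>j \<in> J; n \<in> carrier M\<rbrakk> \<Longrightarrow> j \<odot>\<^bsub>M\<^esub> n \<in> H"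
  shows "smult_span M J \<subseteq> H"
  unfolding smult_span_def
  by (rule group.generate_subgroup_incl[OF M.a_group _ H]) (use assms(2) in blast)

lemma (in module) smult_group_hom:
  "r \<in> carrier R \<Longrightarrow> group_hom (add_monoid M) (add_monoid M) (smult M r)"
  by (simp add: group_hom_def group_hom_axioms_def hom_def M.a_group smult_r_distr)

lemma (in module) smult_span_closed_smult:
  assumes K: "K \<subseteq> carrier R" and r: "r \<in> carrier R" and x: "x \<in> smult_span M K"
  shows "r \<odot>\<^bsub>M\<^esub> x \<in> smult_span M K"
proof -
  have "subgroup {x \<in> carrier M. r \<odot>\<^bsub>M\<^esub> x \<in> smult_span M K} (add_monoid M)"
    using group_hom.subgroup_preimage[OF smult_group_hom[OF r] subgroup_smult_span[OF K]] by simp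
  moreover have "k \<odot>\<^bsub>M\<^esub> n \<in> {x \<in> carrier M. r \<odot>\<^bsub>M\<^esub> x \<in> smult_span M K}"
    if kn: "k \<in> K" "n \<in> carrier M" for k n
  proof -
    have k: "k \<in> carrier R" using kn K by blast
    have "r \<odot>\<^bsub>M\<^esub> (k \<odot>\<^bsub>M\<^esub> n) = k \<odot>\<^bsub>M\<^esub> (r \<odot>\<^bsub>M\<^esub> n)"
      using r k kn(2) by (metis R.m_comm smult_assoc1)
    then show ?thesis using smult_span_incl[of k K "r \<odot>\<^bsub>M\<^esub> n" M] r k kn by simp
  qed
  ultimately show ?thesis using smult_span_subset_subgroup x by blast
qed

lemma (in module) smult_smult_span:
  assumes K: "ideal K R" and L: "ideal L R" and l: "l \<in> L" and x: "x \<in> smult_span M K"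
  shows "l \<odot>\<^bsub>M\<^esub> x \<in> smult_span M (ideal_prod R K L)"
proof -
  have sub: "ideal_prod R K L \<subseteq> carrier R" by (rule R.ideal_prod_in_carrier[OF K L])
  have lR: "l \<in> carrier R" using ideal.Icarr[OF L l] .
  let ?U = "{x \<in> carrier M. l \<odot>\<^bsub>M\<^esub> x \<in> smult_span M (ideal_prod R K L)}"
  have "subgroup ?U (add_monoid M)"
    using group_hom.subgroup_preimage[OF smult_group_hom[OF lR] subgroup_smult_span[OF sub]] by simp
  moreover have "k \<odot>\<^bsub>M\<^esub> n \<in> ?U" if kn: "k \<in> K" "n \<in> carrier M" for k n
  proof -
    have k: "k \<in> carrier R" using ideal.Icarr[OF K kn(1)] .
    have "l \<odot>\<^bsub>M\<^esub> (k \<odot>\<^bsub>M\<^esub> n) = (k \<otimes>\<^bsub>R\<^esub> l) \<odot>\<^bsub>M\<^esub> n"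
      using lR k kn(2) by (metis R.m_comm smult_assoc1)
    then show ?thesis
      using smult_span_incl[OF ideal_prod.prod[OF kn(1) l, of R] kn(2)] k kn by simp
  qed
  ultimately show ?thesis using smult_span_subset_subgroup x by blast
qed

text \<open>If \<^term>\<open>S\<close> generates \<open>L\<close>, then \<open>(K L) M = L (K M)\<close> consists of combinations of the finitely many elements of
\<^term>\<open>S\<close> with coefficients in \<open>K M\<close>. These combinations form a submodule \<open>V\<close>, and the scalars that map
\<open>K M\<close> into \<open>V\<close> form an ideal, which contains \<^term>\<open>S\<close> and therefore all of \<open>L\<close>.\<close>

lemma (in module) smult_span_prod_genideal:
  assumes K: "ideal K R" and S: "finite S" "S \<subseteq> carrier R"
    and x: "x \<in> smult_span M (ideal_prod R K (Idl\<^bsub>R\<^esub> S))"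
  shows "\<exists>y. (\<forall>g\<in>S. y g \<in> smult_span M K) \<and> x = (\<Oplus>\<^bsub>M\<^esub>g\<in>S. g \<odot>\<^bsub>M\<^esub> y g)"
proof -
  have KR: "K \<subseteq> carrier R" using ideal.Icarr[OF K] by blast
  note Q = subgroup_smult_span[OF KR]
  interpret Q: subgroup "smult_span M K" "add_monoid M" by (rule Q)
  have QM: "q \<in> carrier M" if "q \<in> smult_span M K" for q using Q.subset that by auto
  have Qinv: "\<ominus>\<^bsub>M\<^esub> q \<in> smult_span M K" if "q \<in> smult_span M K" for q
    using Q.m_inv_closed[OF that] by (simp add: a_inv_def)
  have gS: "g \<in> carrier R" if "g \<in> S" for g using S that by blast
  define V where "V = {(\<Oplus>\<^bsub>M\<^esub>g\<in>S. g \<odot>\<^bsub>M\<^esub> y g) | y. \<forall>g\<in>S. y g \<in> smult_span M K}"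
  have V_I: "(\<Oplus>\<^bsub>M\<^esub>g\<in>S. g \<odot>\<^bsub>M\<^esub> y g) \<in> V" if "\<And>g. g \<in> S \<Longrightarrow> y g \<in> smult_span M K" for y
    unfolding V_def using that by blast
  have V_smult: "r \<odot>\<^bsub>M\<^esub> v \<in> V" if r: "r \<in> carrier R" and "v \<in> V" for r v
  proof -
    obtain y where y: "\<forall>g\<in>S. y g \<in> smult_span M K" "v = (\<Oplus>\<^bsub>M\<^esub>g\<in>S. g \<odot>\<^bsub>M\<^esub> y g)"
      using \<open>v \<in> V\<close> unfolding V_def by blast
    have "r \<odot>\<^bsub>M\<^esub> v = (\<Oplus>\<^bsub>M\<^esub>g\<in>S. r \<odot>\<^bsub>M\<^esub> (g \<odot>\<^bsub>M\<^esub> y g))"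
      unfolding y(2) by (rule finsum_smult_ldistr[OF S(1) r]) (use y QM gS in auto)
    also have "\<dots> = (\<Oplus>\<^bsub>M\<^esub>g\<in>S. g \<odot>\<^bsub>M\<^esub> (r \<odot>\<^bsub>M\<^esub> y g))"
    proof (rule M.finsum_cong', rule refl)
      fix g assume g: "g \<in> S"
      show "r \<odot>\<^bsub>M\<^esub> (g \<odot>\<^bsub>M\<^esub> y g) = g \<odot>\<^bsub>M\<^esub> (r \<odot>\<^bsub>M\<^esub> y g)"
        using r gS[OF g] QM y(1) g by (metis R.m_comm smult_assoc1)
    qed (use y QM gS r in auto)
    finally have "r \<odot>\<^bsub>M\<^esub> v = \<dots>" .
    moreover have "\<dots> \<in> V" by (rule V_I) (use y(1) smult_span_closed_smult[OF KR r] in blast)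
    ultimately show ?thesis by simp
  qed
  have V_add: "v \<oplus>\<^bsub>M\<^esub> w \<in> V" if "v \<in> V" "w \<in> V" for v w
  proof -
    obtain y where y: "\<forall>g\<in>S. y g \<in> smult_span M K" "v = (\<Oplus>\<^bsub>M\<^esub>g\<in>S. g \<odot>\<^bsub>M\<^esub> y g)"
      using \<open>v \<in> V\<close> unfolding V_def by blast
    obtain z where z: "\<forall>g\<in>S. z g \<in> smult_span M K" "w = (\<Oplus>\<^bsub>M\<^esub>g\<in>S. g \<odot>\<^bsub>M\<^esub> z g)"
      using \<open>w \<in> V\<close> unfolding V_def by blast
    have "v \<oplus>\<^bsub>M\<^esub> w = (\<Oplus>\<^bsub>M\<^esub>g\<in>S. g \<odot>\<^bsub>M\<^esub> y g \<oplus>\<^bsub>M\<^esub> g \<odot>\<^bsub>M\<^esub> z g)"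
      unfolding y(2) z(2) by (rule M.finsum_addf[symmetric]) (use y z QM gS in auto)
    also have "\<dots> = (\<Oplus>\<^bsub>M\<^esub>g\<in>S. g \<odot>\<^bsub>M\<^esub> (y g \<oplus>\<^bsub>M\<^esub> z g))"
      by (rule M.finsum_cong') (use y z QM gS in \<open>auto simp: smult_r_distr\<close>)
    finally have "v \<oplus>\<^bsub>M\<^esub> w = \<dots>" .
    moreover have "\<dots> \<in> V" by (rule V_I) (use y(1) z(1) Q.m_closed in simp)
    ultimately show ?thesis by simp
  qed
  have V_zero: "\<zero>\<^bsub>M\<^esub> \<in> V"
  proof -
    have "(\<Oplus>\<^bsub>M\<^esub>g\<in>S. g \<odot>\<^bsub>M\<^esub> \<zero>\<^bsub>M\<^esub>) = (\<Oplus>\<^bsub>M\<^esub>g\<in>S. \<zero>\<^bsub>M\<^esub>)"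
      by (rule M.finsum_cong') (use gS in auto)
    also have "\<dots> = \<zero>\<^bsub>M\<^esub>" by simp
    finally show ?thesis using V_I[of "\<lambda>_. \<zero>\<^bsub>M\<^esub>"] Q.one_closed by simp
  qed
  have V_carrier: "v \<in> carrier M" if "v \<in> V" for v
    using that gS QM unfolding V_def by (auto intro!: M.finsum_closed)
  have V_inv: "\<ominus>\<^bsub>M\<^esub> v \<in> V" if "v \<in> V" for v
  proof -
    have "(\<ominus>\<^bsub>R\<^esub> \<one>\<^bsub>R\<^esub>) \<odot>\<^bsub>M\<^esub> v = \<ominus>\<^bsub>M\<^esub> v"
      using V_carrier[OF that] by (simp add: smult_l_minus)
    then show ?thesis using V_smult[of "\<ominus>\<^bsub>R\<^esub> \<one>\<^bsub>R\<^esub>" v] that by simp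
  qed
  have V_sub: "subgroup V (add_monoid M)"
    by (rule group.subgroupI[OF M.a_group])
      (use V_carrier V_zero V_add V_inv in \<open>auto simp flip: a_inv_def\<close>)
  have V_gen: "g \<odot>\<^bsub>M\<^esub> q \<in> V" if g: "g \<in> S" and q: "q \<in> smult_span M K" for g q
  proof -
    have "(\<Oplus>\<^bsub>M\<^esub>s\<in>S. s \<odot>\<^bsub>M\<^esub> (if g = s then q else \<zero>\<^bsub>M\<^esub>))
        = (\<Oplus>\<^bsub>M\<^esub>s\<in>S. if g = s then s \<odot>\<^bsub>M\<^esub> q else \<zero>\<^bsub>M\<^esub>)"
      by (rule M.finsum_cong') (use gS QM[OF q] in auto)
    also have "\<dots> = g \<odot>\<^bsub>M\<^esub> q"
      by (rule M.finsum_singleton[OF g S(1)]) (use gS QM[OF q] in auto)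
    finally show ?thesis
      using V_I[of "\<lambda>s. if g = s then q else \<zero>\<^bsub>M\<^esub>"] q Q.one_closed by simp
  qed
  define U where "U = {a \<in> carrier R. \<forall>q\<in>smult_span M K. a \<odot>\<^bsub>M\<^esub> q \<in> V}"
  have "ideal U R"
  proof (rule idealI[OF R.ring_axioms])
    show "subgroup U (add_monoid R)"
    proof (rule group.subgroupI[OF R.a_group])
      show "U \<noteq> {}" using V_zero QM unfolding U_def by (auto intro!: exI[of _ "\<zero>\<^bsub>R\<^esub>"])
      show "inv\<^bsub>add_monoid R\<^esub> a \<in> U" if "a \<in> U" for a
        using that V_inv QM unfolding U_def by (auto simp: smult_l_minus simp flip: a_inv_def)
      show "a \<otimes>\<^bsub>add_monoid R\<^esub> b \<in> U" if "a \<in> U" "b \<in> U" for a b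
        using that V_add QM unfolding U_def by (auto simp: smult_l_distr)
    qed (auto simp: U_def)
    show l: "r \<otimes>\<^bsub>R\<^esub> a \<in> U" if "a \<in> U" "r \<in> carrier R" for a r
      using that V_smult QM unfolding U_def by (auto simp: smult_assoc1)
    show "a \<otimes>\<^bsub>R\<^esub> r \<in> U" if "a \<in> U" "r \<in> carrier R" for a r
      using l[OF that] that R.m_comm[of a r] unfolding U_def by simp
  qed
  moreover have "S \<subseteq> U" using S V_gen unfolding U_def by blast
  ultimately have "Idl\<^bsub>R\<^esub> S \<subseteq> U" by (rule R.genideal_minimal)
  then have U: "l \<in> carrier R" "\<And>q. q \<in> smult_span M K \<Longrightarrow> l \<odot>\<^bsub>M\<^esub> q \<in> V" if "l \<in> Idl\<^bsub>R\<^esub> S" for l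
    using that unfolding U_def by blast+
  have "smult_span M (ideal_prod R K (Idl\<^bsub>R\<^esub> S)) \<subseteq> V"
  proof (rule smult_span_subset_subgroup[OF V_sub])
    fix c n assume c: "c \<in> ideal_prod R K (Idl\<^bsub>R\<^esub> S)" and n: "n \<in> carrier M"
    from c have "c \<in> carrier R \<and> c \<odot>\<^bsub>M\<^esub> n \<in> V"
    proof (induction rule: ideal_prod.induct)
      case (prod k l)
      have kl: "k \<in> carrier R" "l \<in> carrier R" using prod U(1) KR by auto
      have "(k \<otimes>\<^bsub>R\<^esub> l) \<odot>\<^bsub>M\<^esub> n = l \<odot>\<^bsub>M\<^esub> (k \<odot>\<^bsub>M\<^esub> n)"
        using kl n by (metis R.m_comm smult_assoc1)
      then show ?case using U(2)[OF prod(2) smult_span_incl[OF prod(1) n]] kl by simp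
    next
      case (sum a b)
      then show ?case using V_add n by (simp add: smult_l_distr)
    qed
    then show "c \<odot>\<^bsub>M\<^esub> n \<in> V" ..
  qed
  then have "x \<in> V" using x by blast
  then show ?thesis unfolding V_def by blast
qed

lemma module_hom_smult_span:
  assumes M: "module R M" and N: "module R N" and f: "f \<in> module_hom R M N"
    and K: "K \<subseteq> carrier R" and x: "x \<in> smult_span M K"
  shows "f x \<in> smult_span N K"
proof -
  interpret M: module R M by fact
  interpret N: module R N by fact
  interpret f: group_hom "add_monoid M" "add_monoid N" f by (rule module_hom_group_hom[OF M N f])
  have "smult_span M K \<subseteq> {x \<in> carrier (add_monoid M). f x \<in> smult_span N K}"
  proof (rule M.smult_span_subset_subgroup)
    show "subgroup {x \<in> carrier (add_monoid M). f x \<in> smult_span N K} (add_monoid M)"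
      by (rule f.subgroup_preimage) (rule N.subgroup_smult_span[OF K])
    fix k n assume kn: "k \<in> K" "n \<in> carrier M"
    then have "k \<in> carrier R" using K by blast
    then show "k \<odot>\<^bsub>M\<^esub> n \<in> {x \<in> carrier (add_monoid M). f x \<in> smult_span N K}"
      using kn by (simp add: module_homD[OF f] smult_span_incl)
  qed
  then show ?thesis using x by blast
qed

section \<open>Base change along a surjective ring homomorphism\<close>

text \<open>For surjective \<^term>\<open>\<pi>\<close> with kernel \<open>J\<close>, the base change of \<^term>\<open>N\<close> is \<open>N / J N\<close>. The quotient is not
constructed; its description by the elements \<open>1 \<otimes> n\<close> and their equality is what the sequel uses.\<close>

locale surjective_base_change =
  fixes R :: "('r, 'x) ring_scheme" and S :: "('s, 'w) ring_scheme" and \<pi> :: "'r \<Rightarrow> 's"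
    and N :: "('r, 'n, 'z) module_scheme"
  assumes cring_R: "cring R" and cring_S: "cring S" and hom: "\<pi> \<in> ring_hom R S"
    and surj: "\<pi> ` carrier R = carrier S" and module_N: "module R N"
begin

sublocale S: cring S by (rule cring_S)
sublocale N: module R N by (rule module_N)

abbreviation B :: "('r, 's) module" where "B \<equiv> restrict_scalars \<pi> (self_module S)"

abbreviation J :: "'r set" where "J \<equiv> a_kernel R S \<pi>"

abbreviation T :: "('r, ('s \<times> 'n \<Rightarrow>\<^sub>0 int) set) module" where "T \<equiv> tensor R B N"

abbreviation unit_tensor :: "'n \<Rightarrow> ('s \<times> 'n \<Rightarrow>\<^sub>0 int) set"
  where "unit_tensor n \<equiv> pure_tensor R B N \<one>\<^bsub>S\<^esub> n"

lemma module_B: "module R B"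
  by (rule module_restrict_scalars[OF cring_R hom module_self_module[OF cring_S]])

lemma B_simps [simp]:
  "carrier B = carrier S" "ring.add B = ring.add S" "\<zero>\<^bsub>B\<^esub> = \<zero>\<^bsub>S\<^esub>" "r \<odot>\<^bsub>B\<^esub> s = \<pi> r \<otimes>\<^bsub>S\<^esub> s"
  by (simp_all add: restrict_scalars_def self_module_def)

lemma pi_simps [simp]:
  "r \<in> carrier R \<Longrightarrow> \<pi> r \<in> carrier S" "\<pi> \<one>\<^bsub>R\<^esub> = \<one>\<^bsub>S\<^esub>"
  "\<lbrakk>r \<in> carrier R; r' \<in> carrier R\<rbrakk> \<Longrightarrow> \<pi> (r \<oplus>\<^bsub>R\<^esub> r') = \<pi> r \<oplus>\<^bsub>S\<^esub> \<pi> r'"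
  "\<lbrakk>r \<in> carrier R; r' \<in> carrier R\<rbrakk> \<Longrightarrow> \<pi> (r \<otimes>\<^bsub>R\<^esub> r') = \<pi> r \<otimes>\<^bsub>S\<^esub> \<pi> r'"
  by (simp_all only: ring_hom_closed[OF hom] ring_hom_one[OF hom] ring_hom_add[OF hom] ring_hom_mult[OF hom])

lemma pi_zero [simp]: "\<pi> \<zero>\<^bsub>R\<^esub> = \<zero>\<^bsub>S\<^esub>"
  by (rule ring_hom_zero[OF hom N.R.ring_axioms S.ring_axioms])

lemma pi_diff:
  assumes "r \<in> carrier R" "r' \<in> carrier R"
  shows "\<pi> (r \<ominus>\<^bsub>R\<^esub> r') = \<pi> r \<ominus>\<^bsub>S\<^esub> \<pi> r'"
proof -
  have "\<pi> (\<ominus>\<^bsub>R\<^esub> r') \<oplus>\<^bsub>S\<^esub> \<pi> r' = \<pi> (\<ominus>\<^bsub>R\<^esub> r' \<oplus>\<^bsub>R\<^esub> r')"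
    using assms by (simp only: pi_simps N.R.a_inv_closed)
  also have "\<dots> = \<zero>\<^bsub>S\<^esub>" using assms by (simp add: N.R.l_neg)
  finally have "\<ominus>\<^bsub>S\<^esub> \<pi> r' = \<pi> (\<ominus>\<^bsub>R\<^esub> r')"
    using assms S.minus_equality[of "\<pi> (\<ominus>\<^bsub>R\<^esub> r')" "\<pi> r'"] by simp
  then show ?thesis using assms by (simp add: a_minus_def)
qed

lemma kernel_iff: "r \<in> J \<longleftrightarrow> r \<in> carrier R \<and> \<pi> r = \<zero>\<^bsub>S\<^esub>"
  by (simp add: a_kernel_def')

lemma abelian_group_T: "abelian_group T"
  by (rule abelian_group_tensor[OF module_B module_N])

sublocale T: abelian_group T by (rule abelian_group_T)

lemma unit_tensor_closed [simp]: "n \<in> carrier N \<Longrightarrow> unit_tensor n \<in> carrier T"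
  by (rule pure_tensor_closed) simp_all

lemma unit_tensor_add:
  "\<lbrakk>n \<in> carrier N; n' \<in> carrier N\<rbrakk> \<Longrightarrow> unit_tensor (n \<oplus>\<^bsub>N\<^esub> n') = unit_tensor n \<oplus>\<^bsub>T\<^esub> unit_tensor n'"
  by (rule pure_tensor_add_right[OF module_B module_N]) simp_all

lemma unit_tensor_group_hom: "group_hom (add_monoid N) (add_monoid T) unit_tensor"
  by (simp add: group_hom_def group_hom_axioms_def hom_def Pi_iff unit_tensor_add
      N.M.add.is_group T.add.is_group)

interpretation u: group_hom "add_monoid N" "add_monoid T" unit_tensor
  by (rule unit_tensor_group_hom)

lemma pure_tensor_eq_unit_tensor:
  assumes "r \<in> carrier R" "n \<in> carrier N"
  shows "pure_tensor R B N (\<pi> r) n = unit_tensor (r \<odot>\<^bsub>N\<^esub> n)"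
  using pure_tensor_balanced[OF module_B module_N assms(1) _ assms(2), of "\<one>\<^bsub>S\<^esub>"] assms by simp

lemma unit_tensor_smult:
  assumes "r \<in> carrier R" "n \<in> carrier N"
  shows "unit_tensor (r \<odot>\<^bsub>N\<^esub> n) = r \<odot>\<^bsub>T\<^esub> unit_tensor n"
  using tensor_smult_pure_tensor[OF module_B module_N assms(1) _ assms(2), of "\<one>\<^bsub>S\<^esub>"]
    pure_tensor_eq_unit_tensor[OF assms] assms by simp

text \<open>Pure tensors \<open>\<pi>(r) \<otimes> n = 1 \<otimes> r n\<close> are of the required form, which is closed under differences because
\<open>n \<mapsto> 1 \<otimes> n\<close> is additive.\<close>

lemma carrier_T: "carrier T = unit_tensor ` carrier N"
proof
  show "unit_tensor ` carrier N \<subseteq> carrier T" by auto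
  have "tensor_class R B N c \<in> unit_tensor ` carrier N" if "Poly_Mapping.keys c \<subseteq> carrier B \<times> carrier N" for c
    using that
  proof (rule free_Abelian_group_induct)
    interpret L: subgroup "tensor_subgroup R B N" "tensor_free B N"
      by (rule subgroup_tensor_subgroup[OF module_B module_N])
    have "tensor_class R B N 0 = \<zero>\<^bsub>T\<^esub>"
      using group.coset_mult_one[OF group_free_Abelian_group L.subset]
      by (simp add: tensor_def Let_def FactGroup_def tensor_class_def)
    also have "\<dots> = unit_tensor \<zero>\<^bsub>N\<^esub>" using u.hom_one by simp
    finally show "tensor_class R B N 0 \<in> unit_tensor ` carrier N" by auto
  next
    fix x y assume 2: "Poly_Mapping.keys x \<subseteq> carrier B \<times> carrier N" "Poly_Mapping.keys y \<subseteq> carrier B \<times> carrier N"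
      "tensor_class R B N x \<in> unit_tensor ` carrier N" "tensor_class R B N y \<in> unit_tensor ` carrier N"
    then obtain n n' where n: "n \<in> carrier N" "tensor_class R B N x = unit_tensor n"
      "n' \<in> carrier N" "tensor_class R B N y = unit_tensor n'" by auto
    have k: "x - y \<in> carrier (tensor_free B N)"
      using keys_diff[of x y] 2(1,2) by auto
    have cl: "tensor_class R B N (x - y) \<in> carrier T" using k unfolding carrier_tensor by blast
    have "tensor_class R B N (x - y) \<oplus>\<^bsub>T\<^esub> unit_tensor n' = unit_tensor n"
      using tensor_add_class[OF module_B module_N k, of y] 2 n by simp
    also have "\<dots> = unit_tensor (n \<ominus>\<^bsub>N\<^esub> n') \<oplus>\<^bsub>T\<^esub> unit_tensor n'"
      using n by (simp flip: unit_tensor_add add: a_minus_def N.M.a_assoc N.M.l_neg)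
    finally have "tensor_class R B N (x - y) = unit_tensor (n \<ominus>\<^bsub>N\<^esub> n')"
      using n cl by (simp add: T.add.r_cancel)
    then show "tensor_class R B N (x - y) \<in> unit_tensor ` carrier N" using n by auto
  next
    fix p assume "p \<in> carrier B \<times> carrier N"
    then obtain s n where p: "p = (s, n)" "s \<in> carrier S" "n \<in> carrier N" by auto
    then obtain r where r: "r \<in> carrier R" "s = \<pi> r" using surj by auto
    show "tensor_class R B N (frag_of p) \<in> unit_tensor ` carrier N"
      using pure_tensor_eq_unit_tensor[OF r(1) p(3)] p r
      by (auto simp: pure_tensor_def)
  qed
  then show "carrier T \<subseteq> unit_tensor ` carrier N" unfolding carrier_tensor by auto
qed

lemma smult_span_imp_unit_tensor_zero:
  assumes "n \<in> smult_span N J" shows "unit_tensor n = \<zero>\<^bsub>T\<^esub>"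
proof -
  have "smult_span N J \<subseteq> kernel (add_monoid N) (add_monoid T) unit_tensor"
  proof (rule N.smult_span_subset_subgroup[OF u.subgroup_kernel])
    fix j n assume jn: "j \<in> J" "n \<in> carrier N"
    then have j: "j \<in> carrier R" "\<pi> j = \<zero>\<^bsub>S\<^esub>" by (auto simp: kernel_iff)
    have "unit_tensor (j \<odot>\<^bsub>N\<^esub> n) = pure_tensor R B N \<zero>\<^bsub>S\<^esub> n"
      using pure_tensor_eq_unit_tensor[OF j(1) jn(2)] j by simp
    also have "\<dots> = unit_tensor (\<zero>\<^bsub>R\<^esub> \<odot>\<^bsub>N\<^esub> n)"
      using pure_tensor_eq_unit_tensor[OF N.R.zero_closed jn(2)] by simp
    also have "\<dots> = \<zero>\<^bsub>T\<^esub>" using u.hom_one jn by simp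
    finally show "j \<odot>\<^bsub>N\<^esub> n \<in> kernel (add_monoid N) (add_monoid T) unit_tensor"
      using j jn by (simp add: kernel_def)
  qed
  then show ?thesis using assms by (auto simp: kernel_def)
qed

text \<open>Choose a set-theoretic section \<open>\<sigma>\<close> of \<^term>\<open>\<pi>\<close>. The map \<open>(s, n) \<mapsto> \<sigma>(s) n\<close> need not be bilinear, but it is so
modulo \<open>J N\<close>, as the defects of \<open>\<sigma>\<close> lie in the kernel \<open>J\<close>. Hence it induces a map from the tensor product
to \<open>N / J N\<close>, and that map sends \<open>1 \<otimes> n\<close> to the class of \<open>n\<close>.\<close>

lemma unit_tensor_eq_imp_smult_span:
  assumes n: "n \<in> carrier N" "n' \<in> carrier N" and eq: "unit_tensor n = unit_tensor n'"
  shows "n \<ominus>\<^bsub>N\<^esub> n' \<in> smult_span N J"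
proof -
  define \<sigma> where "\<sigma> = inv_into (carrier R) \<pi>"
  have \<sigma>: "\<sigma> s \<in> carrier R" "\<pi> (\<sigma> s) = s" if "s \<in> carrier S" for s
    using that unfolding \<sigma>_def surj[symmetric] by (auto intro: inv_into_into f_inv_into_f)
  define \<phi> where "\<phi> s n = \<sigma> s \<odot>\<^bsub>N\<^esub> n" for s n
  have JR: "J \<subseteq> carrier R" by (auto simp: kernel_iff)
  note H = N.subgroup_smult_span[OF JR]
  interpret H: subgroup "smult_span N J" "add_monoid N" by (rule H)
  have dist: "(a \<ominus>\<^bsub>R\<^esub> b) \<odot>\<^bsub>N\<^esub> n = a \<odot>\<^bsub>N\<^esub> n \<ominus>\<^bsub>N\<^esub> b \<odot>\<^bsub>N\<^esub> n"
    if "a \<in> carrier R" "b \<in> carrier R" "n \<in> carrier N" for a b n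
    using that by (simp add: a_minus_def N.smult_l_distr N.smult_l_minus)
  have bal: "balanced_mod R B N N (smult_span N J) \<phi>"
    unfolding balanced_mod_def
  proof (intro conjI ballI)
    fix s n assume "s \<in> carrier B" "n \<in> carrier N"
    then show "\<phi> s n \<in> carrier N" by (simp add: \<phi>_def \<sigma>)
  next
    fix s t n assume el: "s \<in> carrier B" "t \<in> carrier B" "n \<in> carrier N"
    have "\<phi> (s \<oplus>\<^bsub>B\<^esub> t) n \<ominus>\<^bsub>N\<^esub> \<phi> s n \<ominus>\<^bsub>N\<^esub> \<phi> t n = (\<sigma> (s \<oplus>\<^bsub>S\<^esub> t) \<ominus>\<^bsub>R\<^esub> \<sigma> s \<ominus>\<^bsub>R\<^esub> \<sigma> t) \<odot>\<^bsub>N\<^esub> n"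
      using el by (simp add: \<phi>_def dist \<sigma>)
    moreover have "\<sigma> (s \<oplus>\<^bsub>S\<^esub> t) \<ominus>\<^bsub>R\<^esub> \<sigma> s \<ominus>\<^bsub>R\<^esub> \<sigma> t \<in> J"
      using el by (simp add: kernel_iff pi_diff \<sigma>) (simp add: S.minus_cancel)
    ultimately show "\<phi> (s \<oplus>\<^bsub>B\<^esub> t) n \<ominus>\<^bsub>N\<^esub> \<phi> s n \<ominus>\<^bsub>N\<^esub> \<phi> t n \<in> smult_span N J"
      using el by (simp add: smult_span_incl)
  next
    fix s n n' assume el: "s \<in> carrier B" "n \<in> carrier N" "n' \<in> carrier N"
    have "\<phi> s (n \<oplus>\<^bsub>N\<^esub> n') \<ominus>\<^bsub>N\<^esub> \<phi> s n \<ominus>\<^bsub>N\<^esub> \<phi> s n' = \<zero>\<^bsub>N\<^esub>"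
      using el by (simp add: \<phi>_def \<sigma> N.smult_r_distr N.M.minus_cancel)
    then show "\<phi> s (n \<oplus>\<^bsub>N\<^esub> n') \<ominus>\<^bsub>N\<^esub> \<phi> s n \<ominus>\<^bsub>N\<^esub> \<phi> s n' \<in> smult_span N J"
      using H.one_closed by simp
  next
    fix r s n assume el: "r \<in> carrier R" "s \<in> carrier B" "n \<in> carrier N"
    have "\<phi> (r \<odot>\<^bsub>B\<^esub> s) n \<ominus>\<^bsub>N\<^esub> \<phi> s (r \<odot>\<^bsub>N\<^esub> n) = (\<sigma> (\<pi> r \<otimes>\<^bsub>S\<^esub> s) \<ominus>\<^bsub>R\<^esub> \<sigma> s \<otimes>\<^bsub>R\<^esub> r) \<odot>\<^bsub>N\<^esub> n"
      using el by (simp add: \<phi>_def dist \<sigma> N.smult_assoc1)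
    moreover have "\<sigma> (\<pi> r \<otimes>\<^bsub>S\<^esub> s) \<ominus>\<^bsub>R\<^esub> \<sigma> s \<otimes>\<^bsub>R\<^esub> r \<in> J"
      using el by (simp add: kernel_iff pi_diff \<sigma>) (simp add: S.m_comm)
    ultimately show "\<phi> (r \<odot>\<^bsub>B\<^esub> s) n \<ominus>\<^bsub>N\<^esub> \<phi> s (r \<odot>\<^bsub>N\<^esub> n) \<in> smult_span N J"
      using el by (simp add: smult_span_incl)
  qed
  have carr: "frag_of (\<one>\<^bsub>S\<^esub>, n) \<in> carrier (tensor_free B N)" "frag_of (\<one>\<^bsub>S\<^esub>, n') \<in> carrier (tensor_free B N)"
    using n by simp_all
  then have "frag_of (\<one>\<^bsub>S\<^esub>, n) - frag_of (\<one>\<^bsub>S\<^esub>, n') \<in> tensor_subgroup R B N"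
    using eq tensor_class_eq_iff[OF module_B module_N carr] by (simp add: pure_tensor_def)
  then have "frag_sum N (\<lambda>p. \<phi> (fst p) (snd p)) (frag_of (\<one>\<^bsub>S\<^esub>, n) - frag_of (\<one>\<^bsub>S\<^esub>, n')) \<in> smult_span N J"
    by (rule frag_sum_tensor_subgroup[OF module_B module_N N.M.abelian_group_axioms H bal])
  moreover have "(\<lambda>p. \<phi> (fst p) (snd p)) \<in> carrier B \<times> carrier N \<rightarrow> carrier N"
    by (auto simp: \<phi>_def \<sigma>)
  ultimately have d: "\<phi> \<one>\<^bsub>S\<^esub> n \<ominus>\<^bsub>N\<^esub> \<phi> \<one>\<^bsub>S\<^esub> n' \<in> smult_span N J"
    using n by (simp add: N.M.frag_sum_diff N.M.frag_sum_frag_of \<phi>_def \<sigma>)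
  \<comment> \<open>The section need not preserve the unit, so \<open>\<sigma>(1) x\<close> has to be corrected by \<open>e x\<close>, which lies in \<open>J N\<close>.\<close>
  define e where "e = \<sigma> \<one>\<^bsub>S\<^esub> \<ominus>\<^bsub>R\<^esub> \<one>\<^bsub>R\<^esub>"
  define x where "x = n \<ominus>\<^bsub>N\<^esub> n'"
  have x: "x \<in> carrier N" using n by (simp add: x_def)
  have e: "e \<in> J" by (simp add: e_def kernel_iff pi_diff \<sigma> S.minus_cancel)
  then have eR: "e \<in> carrier R" by (simp add: kernel_iff)
  have "\<sigma> \<one>\<^bsub>S\<^esub> \<odot>\<^bsub>N\<^esub> x = \<phi> \<one>\<^bsub>S\<^esub> n \<ominus>\<^bsub>N\<^esub> \<phi> \<one>\<^bsub>S\<^esub> n'"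
    using n by (simp add: \<phi>_def x_def a_minus_def N.smult_r_distr N.smult_r_minus \<sigma>)
  moreover have "x = \<sigma> \<one>\<^bsub>S\<^esub> \<odot>\<^bsub>N\<^esub> x \<oplus>\<^bsub>N\<^esub> (\<ominus>\<^bsub>N\<^esub> (e \<odot>\<^bsub>N\<^esub> x))"
    using x N.M.minus_cancel(2)[of "\<sigma> \<one>\<^bsub>S\<^esub> \<odot>\<^bsub>N\<^esub> x" x]
    by (simp add: e_def dist \<sigma> a_minus_def[of N])
  moreover have "\<ominus>\<^bsub>N\<^esub> (e \<odot>\<^bsub>N\<^esub> x) \<in> smult_span N J"
    using H.m_inv_closed[OF smult_span_incl[of e J x N, OF e x]] by (simp add: a_inv_def)
  ultimately show ?thesis
    using d H.m_closed[of "\<sigma> \<one>\<^bsub>S\<^esub> \<odot>\<^bsub>N\<^esub> x"] x_def by fastforce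
qed

lemma unit_tensor_eq_iff:
  assumes n: "n \<in> carrier N" "n' \<in> carrier N"
  shows "unit_tensor n = unit_tensor n' \<longleftrightarrow> n \<ominus>\<^bsub>N\<^esub> n' \<in> smult_span N J"
proof
  assume "n \<ominus>\<^bsub>N\<^esub> n' \<in> smult_span N J"
  then have "unit_tensor (n \<ominus>\<^bsub>N\<^esub> n') = \<zero>\<^bsub>T\<^esub>" by (rule smult_span_imp_unit_tensor_zero)
  moreover have "unit_tensor n = unit_tensor (n \<ominus>\<^bsub>N\<^esub> n') \<oplus>\<^bsub>T\<^esub> unit_tensor n'"
    using n by (simp flip: unit_tensor_add add: a_minus_def N.M.a_assoc N.M.l_neg)
  ultimately show "unit_tensor n = unit_tensor n'" using n by simp
qed (rule unit_tensor_eq_imp_smult_span[OF n])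

lemma base_change_lift_unit_tensor:
  assumes P: "module S P" and h: "h \<in> module_hom R N (restrict_scalars \<pi> P)" and n: "n \<in> carrier N"
  shows "base_change_lift P h (unit_tensor n) = h n"
proof -
  interpret P: module S P by (rule P)
  have h': "h n \<in> carrier P" if "n \<in> carrier N" for n
    using h that by (auto simp: module_hom_def restrict_scalars_def)
  have hadd: "h (x \<oplus>\<^bsub>N\<^esub> y) = h x \<oplus>\<^bsub>P\<^esub> h y" if "x \<in> carrier N" "y \<in> carrier N" for x y
    using h that by (simp add: module_hom_def restrict_scalars_def)
  have hsm: "h (r \<odot>\<^bsub>N\<^esub> x) = \<pi> r \<odot>\<^bsub>P\<^esub> h x" if "r \<in> carrier R" "x \<in> carrier N" for r x
    using h that by (simp add: module_hom_def restrict_scalars_def)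
  have "balanced_mod R B N P {\<zero>\<^bsub>P\<^esub>} (\<lambda>s n. s \<odot>\<^bsub>P\<^esub> h n)"
    unfolding balanced_mod_def
    by (simp add: h' hadd hsm P.smult_l_distr P.smult_r_distr P.smult_assoc1[symmetric] S.m_comm
        P.M.minus_cancel)
  then show ?thesis
    unfolding base_change_lift_def
    using tensor_lift_pure_tensor[OF module_B module_N P.M.abelian_group_axioms, of _ "\<one>\<^bsub>S\<^esub>" n] n h'
    by simp
qed

lemma bij_betw_base_change_lift_iff:
  assumes P: "module S P" and h: "h \<in> module_hom R N (restrict_scalars \<pi> P)"
  shows "bij_betw (base_change_lift P h) (carrier T) (carrier P) \<longleftrightarrow>
    h ` carrier N = carrier P \<and> (\<forall>n\<in>carrier N. h n = \<zero>\<^bsub>P\<^esub> \<longrightarrow> n \<in> smult_span N J)"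
proof -
  interpret P: module S P by (rule P)
  interpret h: group_hom "add_monoid N" "add_monoid P" h
    using h by (simp add: group_hom_def group_hom_axioms_def hom_def module_hom_def restrict_scalars_def
        Pi_iff N.M.add.is_group P.M.add.is_group)
  have zero_eq: "n \<ominus>\<^bsub>N\<^esub> \<zero>\<^bsub>N\<^esub> = n" if "n \<in> carrier N" for n
    using that by (simp add: a_minus_def)
  have hcl: "h n \<in> carrier P" if "n \<in> carrier N" for n using h.hom_closed that by simp
  have hd: "h (n \<ominus>\<^bsub>N\<^esub> n') = h n \<ominus>\<^bsub>P\<^esub> h n'" if "n \<in> carrier N" "n' \<in> carrier N" for n n'
    using that h.hom_mult h.hom_inv by (simp add: a_minus_def a_inv_def)
  have 1: "base_change_lift P h ` carrier T = h ` carrier N"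
    unfolding carrier_T image_image using base_change_lift_unit_tensor[OF P h] by simp
  have 2: "inj_on (base_change_lift P h) (carrier T) \<longleftrightarrow>
      (\<forall>n\<in>carrier N. \<forall>n'\<in>carrier N. h n = h n' \<longrightarrow> n \<ominus>\<^bsub>N\<^esub> n' \<in> smult_span N J)"
    unfolding carrier_T inj_on_def
    by (simp add: base_change_lift_unit_tensor[OF P h] unit_tensor_eq_iff)
  also have "\<dots> \<longleftrightarrow> (\<forall>n\<in>carrier N. h n = \<zero>\<^bsub>P\<^esub> \<longrightarrow> n \<in> smult_span N J)"
  proof safe
    fix n assume *: "\<forall>n\<in>carrier N. \<forall>n'\<in>carrier N. h n = h n' \<longrightarrow> n \<ominus>\<^bsub>N\<^esub> n' \<in> smult_span N J"
      and n: "n \<in> carrier N" "h n = \<zero>\<^bsub>P\<^esub>"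
    then show "n \<in> smult_span N J"
      using bspec[OF bspec[OF * n(1)] N.M.zero_closed] h.hom_one zero_eq by simp
  next
    fix n n' assume *: "\<forall>n\<in>carrier N. h n = \<zero>\<^bsub>P\<^esub> \<longrightarrow> n \<in> smult_span N J"
      and n: "n \<in> carrier N" "n' \<in> carrier N" "h n = h n'"
    have "h (n \<ominus>\<^bsub>N\<^esub> n') = \<zero>\<^bsub>P\<^esub>"
      using n hd hcl P.M.minus_eq_zero_iff by simp
    then show "n \<ominus>\<^bsub>N\<^esub> n' \<in> smult_span N J" using * n by simp
  qed
  finally show ?thesis unfolding bij_betw_def 1 by (simp only: conj_commute)
qed

end

section \<open>Inverse limits\<close>

lemma inverse_limit_simps:
  "x \<in> carrier (inverse_limit P \<nu>) \<longleftrightarrow> (\<forall>k. x k \<in> carrier (P k) \<and> \<nu> k (x (Suc k)) = x k)"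
  "\<zero>\<^bsub>inverse_limit P \<nu>\<^esub> = (\<lambda>k. \<zero>\<^bsub>P k\<^esub>)"
  "x \<oplus>\<^bsub>inverse_limit P \<nu>\<^esub> y = (\<lambda>k. x k \<oplus>\<^bsub>P k\<^esub> y k)"
  "r \<odot>\<^bsub>inverse_limit P \<nu>\<^esub> x = (\<lambda>k. r \<odot>\<^bsub>P k\<^esub> x k)"
  by (simp_all add: inverse_limit_def)

lemma module_inverse_limit:
  assumes P: "\<And>k. module R (P k)" and \<nu>: "\<And>k. \<nu> k \<in> module_hom R (P (Suc k)) (P k)"
  shows "module R (inverse_limit P \<nu>)"
proof -
  interpret P: module R "P k" for k by (rule P)
  note hom = module_homD[OF \<nu>]
  have "abelian_group (inverse_limit P \<nu>)"
  proof (rule abelian_groupI)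
    fix x assume x: "x \<in> carrier (inverse_limit P \<nu>)"
    then have xk: "x k \<in> carrier (P k)" "\<nu> k (x (Suc k)) = x k" for k
      by (simp_all add: inverse_limit_simps)
    show "\<exists>y\<in>carrier (inverse_limit P \<nu>). y \<oplus>\<^bsub>inverse_limit P \<nu>\<^esub> x = \<zero>\<^bsub>inverse_limit P \<nu>\<^esub>"
    proof
      have "\<nu> k (\<ominus>\<^bsub>P (Suc k)\<^esub> x (Suc k)) = \<ominus>\<^bsub>P k\<^esub> x k" for k
        using group_hom.hom_inv[OF module_hom_group_hom[OF P P \<nu>], of "x (Suc k)" k] xk
        by (simp add: a_inv_def)
      then show "(\<lambda>k. \<ominus>\<^bsub>P k\<^esub> x k) \<in> carrier (inverse_limit P \<nu>)"
        using xk by (simp add: inverse_limit_simps)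
      show "(\<lambda>k. \<ominus>\<^bsub>P k\<^esub> x k) \<oplus>\<^bsub>inverse_limit P \<nu>\<^esub> x = \<zero>\<^bsub>inverse_limit P \<nu>\<^esub>"
        using xk by (simp add: inverse_limit_simps P.M.l_neg)
    qed
  next
    show "\<zero>\<^bsub>inverse_limit P \<nu>\<^esub> \<in> carrier (inverse_limit P \<nu>)"
      by (simp add: inverse_limit_simps module_hom_zero[OF P P \<nu>])
  qed (simp_all add: inverse_limit_simps hom P.M.a_ac)
  then show ?thesis
    by (rule moduleI[OF P.R.cring_axioms])
      (simp_all add: inverse_limit_simps hom P.smult_l_distr P.smult_r_distr P.smult_assoc1)
qed

lemma inverse_limit_proj_hom: "(\<lambda>x. x k) \<in> module_hom R (inverse_limit P \<nu>) (P k)"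
  by (auto simp: module_hom_def inverse_limit_simps)

text \<open>A compatible sequence through \<^term>\<open>y\<close> is determined by \<^term>\<open>y\<close> up to the index \<open>k\<close> and is continued above \<open>k\<close> by
choosing preimages one after the other.\<close>

lemma inverse_limit_proj_surj:
  assumes surj: "\<And>k. \<nu> k ` carrier (P (Suc k)) = carrier (P k)" and y: "y \<in> carrier (P k)"
  shows "\<exists>x\<in>carrier (inverse_limit P \<nu>). x k = y"
proof -
  have "\<exists>d. d k = y \<and> (\<forall>l\<le>k. d l \<in> carrier (P l)) \<and> (\<forall>l<k. \<nu> l (d (Suc l)) = d l)"
    using y
  proof (induction k arbitrary: y)
    case 0 then show ?case by auto
  next
    case (Suc k)
    have "\<nu> k y \<in> carrier (P k)" using Suc.prems surj by blast
    from Suc.IH[OF this] obtain d where d: "d k = \<nu> k y"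
      "\<forall>l\<le>k. d l \<in> carrier (P l)" "\<forall>l<k. \<nu> l (d (Suc l)) = d l" by blast
    show ?case
      by (rule exI[of _ "d(Suc k := y)"]) (use d Suc.prems in \<open>auto simp: le_Suc_eq less_Suc_eq\<close>)
  qed
  then obtain d where d: "d k = y" "\<forall>l\<le>k. d l \<in> carrier (P l)" "\<forall>l<k. \<nu> l (d (Suc l)) = d l"
    by blast
  have "\<exists>u. \<forall>n. (u n \<in> carrier (P (k + n)) \<and> (n = 0 \<longrightarrow> u n = y)) \<and> \<nu> (k + n) (u (Suc n)) = u n"
  proof (rule dependent_nat_choice)
    show "\<exists>u. u \<in> carrier (P (k + 0)) \<and> (0 = 0 \<longrightarrow> u = y)" using y by simp
    fix u n assume "u \<in> carrier (P (k + n)) \<and> (n = 0 \<longrightarrow> u = y)"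
    then have "u \<in> \<nu> (k + n) ` carrier (P (Suc (k + n)))" using surj by simp
    then show "\<exists>v. (v \<in> carrier (P (k + Suc n)) \<and> (Suc n = 0 \<longrightarrow> v = y)) \<and> \<nu> (k + n) v = u" by auto
  qed
  then obtain u where u: "\<And>n. u n \<in> carrier (P (k + n))" "u 0 = y" "\<And>n. \<nu> (k + n) (u (Suc n)) = u n"
    by blast
  define x where "x l = (if l \<le> k then d l else u (l - k))" for l
  have "x l \<in> carrier (P l)" for l
    using d(2) u(1)[of "l - k"] unfolding x_def by auto
  moreover have "\<nu> l (x (Suc l)) = x l" for l
  proof (cases "l < k")
    case True then show ?thesis using d(3) unfolding x_def by auto
  next
    case False
    then have "x l = u (l - k)" "x (Suc l) = u (Suc (l - k))"
      using d(1) u(2) unfolding x_def by (auto simp: Suc_diff_le)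
    then show ?thesis using u(3)[of "l - k"] False by simp
  qed
  moreover have "x k = y" using d(1) unfolding x_def by simp
  ultimately show ?thesis by (auto simp: inverse_limit_simps)
qed

section \<open>The limit of an adic tower\<close>

locale adic_ideal =
  fixes A :: "('a, 'x) ring_scheme" and I :: "'a set"
  assumes cring_A: "cring A" and ideal_I: "ideal I A"
begin

sublocale A: cring A by (rule cring_A)

text \<open>The powers are counted from \<open>I\<^sup>0 = A\<close> here, where the induction on the filtration starts; \<^const>\<open>adic_power\<close> at
\<open>k\<close> is the power \<open>k + 1\<close>.\<close>

abbreviation pw :: "nat \<Rightarrow> 'a set" where "pw n \<equiv> I [^]\<^bsub>ideals_set A\<^esub> n"

lemma pw_0: "pw 0 = carrier A"
  by (simp add: nat_pow_def) (simp add: ideals_set_def)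

lemma pw_Suc: "pw (Suc n) = ideal_prod A (pw n) I"
  by (simp add: nat_pow_def) (simp add: ideals_set_def)

lemma ideal_pw: "ideal (pw n) A"
  by (induction n) (simp_all only: pw_0 pw_Suc A.oneideal A.ideal_prod_is_ideal ideal_I)

lemma pw_carrier: "pw n \<subseteq> carrier A"
  using ideal.Icarr[OF ideal_pw] by blast

lemma pw_antimono: "m \<le> n \<Longrightarrow> pw n \<subseteq> pw m"
  by (rule lift_Suc_antimono_le[of pw]) (use A.ideal_prod_inter[OF ideal_pw ideal_I] in \<open>unfold pw_Suc, blast\<close>)

end

text \<open>An adic system as a tower of \<^term>\<open>A\<close>-modules, with the tensor products eliminated. The set \<^term>\<open>S\<close> is a
finite generating set of the ideal.\<close>

locale adic_tower = adic_ideal A I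
  for A :: "('a, 'x) ring_scheme" and I :: "'a set" +
  fixes S :: "'a set" and P :: "nat \<Rightarrow> ('a, 'm, 'y) module_scheme" and \<nu> :: "nat \<Rightarrow> 'm \<Rightarrow> 'm"
  assumes gens: "finite S" "S \<subseteq> carrier A" "I = Idl\<^bsub>A\<^esub> S"
    and P: "\<And>k. module A (P k)" and \<nu>: "\<And>k. \<nu> k \<in> module_hom A (P (Suc k)) (P k)"
    and surj: "\<And>k. \<nu> k ` carrier (P (Suc k)) = carrier (P k)"
    and ker: "\<And>k x. \<lbrakk>x \<in> carrier (P (Suc k)); \<nu> k x = \<zero>\<^bsub>P k\<^esub>\<rbrakk>
      \<Longrightarrow> x \<in> smult_span (P (Suc k)) (pw (Suc k))"
    and annih: "\<And>k a x. \<lbrakk>a \<in> pw (Suc k); x \<in> carrier (P k)\<rbrakk>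
      \<Longrightarrow> a \<odot>\<^bsub>P k\<^esub> x = \<zero>\<^bsub>P k\<^esub>"
begin

sublocale P: module A "P k" for k by (rule P)

abbreviation N :: "('a, nat \<Rightarrow> 'm) module" where "N \<equiv> inverse_limit P \<nu>"

lemma module_N: "module A N"
  by (rule module_inverse_limit) (rule P \<nu>)+

sublocale N: module A N by (rule module_N)

lemma proj_hom: "(\<lambda>x. x k) \<in> module_hom A N (P k)"
  by (rule inverse_limit_proj_hom)

lemma proj_surj: "y \<in> carrier (P k) \<Longrightarrow> \<exists>x\<in>carrier N. x k = y"
  by (rule inverse_limit_proj_surj) (rule surj)

lemma N_D:
  assumes "x \<in> carrier N" shows "x k \<in> carrier (P k)" "\<nu> k (x (Suc k)) = x k"
  using assms by (simp_all add: inverse_limit_simps)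

lemma smult_span_annih:
  assumes "l < n" "x \<in> smult_span (P l) (pw n)" shows "x = \<zero>\<^bsub>P l\<^esub>"
proof -
  have "smult_span (P l) (pw n) \<subseteq> {\<zero>\<^bsub>P l\<^esub>}"
  proof (rule P.smult_span_subset_subgroup)
    show "subgroup {\<zero>\<^bsub>P l\<^esub>} (add_monoid (P l))" using P.M.add.triv_subgroup by simp
    fix a x assume "a \<in> pw n" "x \<in> carrier (P l)"
    moreover have "pw n \<subseteq> pw (Suc l)" using assms(1) by (intro pw_antimono) simp
    ultimately show "a \<odot>\<^bsub>P l\<^esub> x \<in> {\<zero>\<^bsub>P l\<^esub>}" using annih by blast
  qed
  then show ?thesis using assms(2) by blast
qed

lemma component_smult_span:
  assumes z: "z \<in> carrier N" "z m \<in> smult_span (P m) (pw n)" and l: "l \<le> m"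
  shows "z l \<in> smult_span (P l) (pw n)"
  using l
proof (induction rule: inc_induct)
  case base show ?case by (rule z(2))
next
  case (step l)
  show ?case
    using module_hom_smult_span[OF P P \<nu> pw_carrier step.IH] N_D(2)[OF z(1), of l] by simp
qed

lemma component_zero:
  assumes x: "x \<in> carrier N" "x m = \<zero>\<^bsub>P m\<^esub>" and l: "l \<le> m"
  shows "x l = \<zero>\<^bsub>P l\<^esub>"
  using l
proof (induction rule: inc_induct)
  case base show ?case by (rule x(2))
next
  case (step l)
  then show ?case using N_D(2)[OF x(1), of l] module_hom_zero[OF P P \<nu>, of l] by simp
qed

lemma smult_span_imp_component_zero:
  assumes x: "x \<in> smult_span N (pw (Suc k))" shows "x k = \<zero>\<^bsub>P k\<^esub>"
  by (rule smult_span_annih[OF lessI]) (rule module_hom_smult_span[OF module_N P proj_hom pw_carrier x])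

lemma finsum_component:
  assumes "\<And>g. g \<in> S \<Longrightarrow> z g \<in> carrier N"
  shows "(\<Oplus>\<^bsub>N\<^esub>g\<in>S. g \<odot>\<^bsub>N\<^esub> z g) l = (\<Oplus>\<^bsub>P l\<^esub>g\<in>S. g \<odot>\<^bsub>P l\<^esub> z g l)"
proof -
  have "g \<odot>\<^bsub>N\<^esub> z g \<in> carrier N" if "g \<in> S" for g using that gens(2) assms by auto
  from module_hom_finsum[OF module_N P proj_hom[of l] gens(1) this] show ?thesis
    by (simp add: inverse_limit_simps)
qed

text \<open>The error of the approximation of \<^term>\<open>x\<close> by \<open>\<Sum> g Z\<^sub>g\<close> in the component \<open>n + 1\<close> lies in the kernel of the
transition, so it is a combination \<open>\<Sum> g y\<^sub>g\<close> with \<open>y\<^sub>g\<close> in \<open>I\<^sup>n P\<^sub>n\<^sub>+\<^sub>1\<close>. Correcting by lifts of the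
\<open>y\<^sub>g\<close> does not disturb the components below \<open>n\<close>, since the images of the \<open>y\<^sub>g\<close> there are zero.\<close>

lemma approximation_step:
  assumes x: "x \<in> carrier N" and Z: "\<And>g. g \<in> S \<Longrightarrow> Z g \<in> carrier N"
    and eq: "x n = (\<Oplus>\<^bsub>P n\<^esub>g\<in>S. g \<odot>\<^bsub>P n\<^esub> Z g n)"
  shows "\<exists>Z'. (\<forall>g\<in>S. Z' g \<in> carrier N \<and> (\<forall>l<n. Z' g l = Z g l)) \<and>
    x (Suc n) = (\<Oplus>\<^bsub>P (Suc n)\<^esub>g\<in>S. g \<odot>\<^bsub>P (Suc n)\<^esub> Z' g (Suc n))"
proof -
  let ?Q = "P (Suc n)"
  have gA: "g \<in> carrier A" if "g \<in> S" for g using that gens(2) by blast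
  define v where "v = (\<Oplus>\<^bsub>N\<^esub>g\<in>S. g \<odot>\<^bsub>N\<^esub> Z g)"
  have v: "v \<in> carrier N" unfolding v_def using Z gA by (auto intro!: N.M.finsum_closed)
  have vl: "v l = (\<Oplus>\<^bsub>P l\<^esub>g\<in>S. g \<odot>\<^bsub>P l\<^esub> Z g l)" for l
    unfolding v_def by (rule finsum_component[OF Z])
  define d where "d = x (Suc n) \<ominus>\<^bsub>?Q\<^esub> v (Suc n)"
  have d: "d \<in> carrier ?Q" unfolding d_def using N_D(1)[OF x] N_D(1)[OF v] by simp
  have "\<nu> n d = x n \<ominus>\<^bsub>P n\<^esub> v n"
    unfolding d_def using module_hom_minus[OF P P \<nu> N_D(1)[OF x] N_D(1)[OF v]] N_D(2)[OF x] N_D(2)[OF v]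
    by simp
  also have "\<dots> = \<zero>\<^bsub>P n\<^esub>" using N_D(1)[OF x, of n] P.M.minus_self[of "x n" n] by (simp only: vl eq[symmetric])
  finally have "d \<in> smult_span ?Q (ideal_prod A (pw n) (Idl\<^bsub>A\<^esub> S))"
    using ker[OF d] by (simp only: pw_Suc gens(3)[symmetric])
  from P.smult_span_prod_genideal[OF ideal_pw gens(1,2) this]
  obtain y where y: "\<And>g. g \<in> S \<Longrightarrow> y g \<in> smult_span ?Q (pw n)"
    "d = (\<Oplus>\<^bsub>?Q\<^esub>g\<in>S. g \<odot>\<^bsub>?Q\<^esub> y g)" by blast
  have yc: "y g \<in> carrier ?Q" if "g \<in> S" for g
    using subgroup.subset[OF P.subgroup_smult_span[OF pw_carrier]] y(1)[OF that] by auto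
  have "\<forall>g\<in>S. \<exists>z\<in>carrier N. z (Suc n) = y g" using proj_surj yc by blast
  then obtain z where z: "\<And>g. g \<in> S \<Longrightarrow> z g \<in> carrier N" "\<And>g. g \<in> S \<Longrightarrow> z g (Suc n) = y g"
    by metis
  \<comment> \<open>For \<open>l < n\<close> the component \<open>l\<close> lies in \<open>I\<^sup>n P\<^sub>l\<close>, which vanishes as \<open>n \<ge> l + 1\<close>.\<close>
  have low: "z g l = \<zero>\<^bsub>P l\<^esub>" if "g \<in> S" "l < n" for g l
    by (rule smult_span_annih[OF that(2)], rule component_smult_span[of _ "Suc n"])
      (use z y that in auto)
  define Z' where "Z' g = Z g \<oplus>\<^bsub>N\<^esub> z g" for g
  have "Z' g \<in> carrier N \<and> (\<forall>l<n. Z' g l = Z g l)" if g: "g \<in> S" for g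
  proof
    show "Z' g \<in> carrier N" unfolding Z'_def by (rule N.M.a_closed[OF Z[OF g] z(1)[OF g]])
    show "\<forall>l<n. Z' g l = Z g l"
      using low[OF g] N_D(1)[OF Z[OF g]] by (simp add: Z'_def inverse_limit_simps(3))
  qed
  moreover have "x (Suc n) = (\<Oplus>\<^bsub>?Q\<^esub>g\<in>S. g \<odot>\<^bsub>?Q\<^esub> Z' g (Suc n))"
  proof -
    have "(\<Oplus>\<^bsub>?Q\<^esub>g\<in>S. g \<odot>\<^bsub>?Q\<^esub> Z' g (Suc n))
        = (\<Oplus>\<^bsub>?Q\<^esub>g\<in>S. g \<odot>\<^bsub>?Q\<^esub> Z g (Suc n) \<oplus>\<^bsub>?Q\<^esub> g \<odot>\<^bsub>?Q\<^esub> y g)"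
    proof (rule P.M.finsum_cong', rule refl)
      fix g assume g: "g \<in> S"
      show "g \<odot>\<^bsub>?Q\<^esub> Z' g (Suc n) = g \<odot>\<^bsub>?Q\<^esub> Z g (Suc n) \<oplus>\<^bsub>?Q\<^esub> g \<odot>\<^bsub>?Q\<^esub> y g"
        using gA[OF g] N_D(1)[OF Z[OF g]] yc[OF g] z(2)[OF g]
        by (simp add: Z'_def inverse_limit_simps(3) P.smult_r_distr)
    qed (use gA N_D(1)[OF Z] yc in auto)
    also have "\<dots> = v (Suc n) \<oplus>\<^bsub>?Q\<^esub> d"
      unfolding vl y(2) by (rule P.M.finsum_addf) (use gA N_D(1)[OF Z] yc in auto)
    also have "\<dots> = x (Suc n)"
      using P.M.minus_cancel(3)[OF N_D(1)[OF x] N_D(1)[OF v], of "Suc n"]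
        P.M.a_comm[OF d N_D(1)[OF v]] by (simp only: d_def)
    finally show ?thesis by simp
  qed
  ultimately show ?thesis by blast
qed

text \<open>The inclusion \<open>F\<^sub>k\<^sub>+\<^sub>1 \<subseteq> I F\<^sub>k\<close>, where \<open>F\<^sub>k\<close> consists of the elements whose components below \<open>k\<close> vanish.
Starting from zero, iterate the approximation step; each component of the coefficients is eventually
constant, and these constants are the coefficients sought.\<close>

lemma component_zero_imp_combination:
  assumes x: "x \<in> carrier N" "x k = \<zero>\<^bsub>P k\<^esub>"
  shows "\<exists>z. (\<forall>g\<in>S. z g \<in> carrier N \<and> (\<forall>l<k. z g l = \<zero>\<^bsub>P l\<^esub>)) \<and> x = (\<Oplus>\<^bsub>N\<^esub>g\<in>S. g \<odot>\<^bsub>N\<^esub> z g)"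
proof -
  have gA: "g \<in> carrier A" if "g \<in> S" for g using that gens(2) by blast
  define low where "low Z \<longleftrightarrow> (\<forall>g\<in>S. Z g \<in> carrier N \<and> (\<forall>l<k. Z g l = \<zero>\<^bsub>P l\<^esub>))" for Z
  define approx where "approx j Z \<longleftrightarrow>
    x (k + j) = (\<Oplus>\<^bsub>P (k + j)\<^esub>g\<in>S. g \<odot>\<^bsub>P (k + j)\<^esub> Z g (k + j))" for j Z
  have "\<exists>Z. \<forall>j. (low (Z j) \<and> approx j (Z j)) \<and> (\<forall>g\<in>S. \<forall>l<k + j. Z (Suc j) g l = Z j g l)"
  proof (rule dependent_nat_choice)
    have "(\<Oplus>\<^bsub>P k\<^esub>g\<in>S. g \<odot>\<^bsub>P k\<^esub> \<zero>\<^bsub>P k\<^esub>) = (\<Oplus>\<^bsub>P k\<^esub>g\<in>S. \<zero>\<^bsub>P k\<^esub>)"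
      by (rule P.M.finsum_cong') (use gA in auto)
    then have "approx 0 (\<lambda>g. \<zero>\<^bsub>N\<^esub>)" unfolding approx_def using x(2) by (simp add: inverse_limit_simps(2))
    moreover have "low (\<lambda>g. \<zero>\<^bsub>N\<^esub>)"
      unfolding low_def using N.M.zero_closed by (simp add: inverse_limit_simps(2))
    ultimately show "\<exists>Z. low Z \<and> approx 0 Z" by blast
  next
    fix Z j assume Z: "low Z \<and> approx j Z"
    then have ZN: "\<And>g. g \<in> S \<Longrightarrow> Z g \<in> carrier N"
      and Zx: "x (k + j) = (\<Oplus>\<^bsub>P (k + j)\<^esub>g\<in>S. g \<odot>\<^bsub>P (k + j)\<^esub> Z g (k + j))"
      unfolding low_def approx_def by blast+
    from approximation_step[OF x(1) ZN Zx] obtain Z' where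
      Z': "\<forall>g\<in>S. Z' g \<in> carrier N \<and> (\<forall>l<k + j. Z' g l = Z g l)"
      "x (Suc (k + j)) = (\<Oplus>\<^bsub>P (Suc (k + j))\<^esub>g\<in>S. g \<odot>\<^bsub>P (Suc (k + j))\<^esub> Z' g (Suc (k + j)))"
      by blast
    have "low Z'" using Z Z'(1) unfolding low_def by simp
    moreover have "approx (Suc j) Z'" using Z'(2) unfolding approx_def by simp
    ultimately show "\<exists>Z'. (low Z' \<and> approx (Suc j) Z') \<and> (\<forall>g\<in>S. \<forall>l<k + j. Z' g l = Z g l)"
      using Z'(1) by blast
  qed
  then obtain Z where low: "\<And>j. low (Z j)" and approx: "\<And>j. approx j (Z j)"
    and agree: "\<And>j g l. \<lbrakk>g \<in> S; l < k + j\<rbrakk> \<Longrightarrow> Z (Suc j) g l = Z j g l"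
    by blast
  have ZN: "Z j g \<in> carrier N" if "g \<in> S" for j g using low[of j] that unfolding low_def by blast
  \<comment> \<open>The step from \<open>Z j\<close> to \<open>Z (Suc j)\<close> preserves the components below \<open>k + j\<close>, so component \<open>l\<close> is final from \<open>j = l + 1\<close> on.\<close>
  define z where "z g l = Z (Suc l) g l" for g l
  have stable: "Z j g l = z g l" if g: "g \<in> S" and "Suc l \<le> j" for j g l
    using that(2)
  proof (induction rule: dec_induct)
    case base show ?case by (simp add: z_def)
  next
    case (step j)
    have "Z (Suc j) g l = Z j g l" by (rule agree[OF g]) (use step in simp)
    then show ?case using step by simp
  qed
  have zN: "z g \<in> carrier N" if g: "g \<in> S" for g
    unfolding inverse_limit_simps
  proof (intro allI conjI)
    fix l
    show "z g l \<in> carrier (P l)" unfolding z_def by (rule N_D(1)[OF ZN[OF g]])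
    have "z g (Suc l) = Z (Suc (Suc l)) g (Suc l)" "z g l = Z (Suc (Suc l)) g l"
      using stable[OF g, of "Suc l" "Suc (Suc l)"] stable[OF g, of l "Suc (Suc l)"] by simp_all
    then show "\<nu> l (z g (Suc l)) = z g l" using N_D(2)[OF ZN[OF g]] by simp
  qed
  have "x l = (\<Oplus>\<^bsub>P l\<^esub>g\<in>S. g \<odot>\<^bsub>P l\<^esub> z g l)" for l
  proof -
    define j where "j = Suc l"
    define w where "w = (\<Oplus>\<^bsub>N\<^esub>g\<in>S. g \<odot>\<^bsub>N\<^esub> Z j g)"
    have w: "w \<in> carrier N" unfolding w_def using ZN gA by (auto intro!: N.M.finsum_closed)
    have wm: "w m = (\<Oplus>\<^bsub>P m\<^esub>g\<in>S. g \<odot>\<^bsub>P m\<^esub> Z j g m)" for m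
      unfolding w_def by (rule finsum_component[OF ZN])
    have down: "x m = w m" if "m \<le> k + j" for m
      using that
    proof (induction rule: inc_induct)
      case base show ?case using approx[of j] unfolding wm approx_def .
    next
      case (step m) then show ?case using N_D(2)[OF x(1), of m] N_D(2)[OF w, of m] by simp
    qed
    have "x l = w l" by (rule down) (simp add: j_def)
    also have "\<dots> = (\<Oplus>\<^bsub>P l\<^esub>g\<in>S. g \<odot>\<^bsub>P l\<^esub> z g l)"
      unfolding wm by (rule P.M.finsum_cong') (use gA N_D(1)[OF zN] stable[of _ l j] in \<open>auto simp: j_def\<close>)
    finally show ?thesis .
  qed
  then have "x = (\<Oplus>\<^bsub>N\<^esub>g\<in>S. g \<odot>\<^bsub>N\<^esub> z g)" by (auto simp: finsum_component[OF zN])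
  moreover have "\<forall>g\<in>S. z g \<in> carrier N \<and> (\<forall>l<k. z g l = \<zero>\<^bsub>P l\<^esub>)"
    using zN low unfolding z_def low_def by blast
  ultimately show ?thesis by blast
qed

text \<open>The inclusion \<open>F\<^sub>k \<subseteq> I\<^sup>k N\<close>, by induction from \<open>F\<^sub>k\<^sub>+\<^sub>1 \<subseteq> I F\<^sub>k\<close>.\<close>

lemma components_zero_imp_smult_span:
  "\<lbrakk>x \<in> carrier N; \<And>l. l < k \<Longrightarrow> x l = \<zero>\<^bsub>P l\<^esub>\<rbrakk> \<Longrightarrow> x \<in> smult_span N (pw k)"
proof (induction k arbitrary: x)
  case 0
  then have "\<one>\<^bsub>A\<^esub> \<odot>\<^bsub>N\<^esub> x \<in> smult_span N (pw 0)"
    by (intro smult_span_incl) (simp_all only: pw_0 A.one_closed)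
  then show ?case using N.smult_one[OF 0(1)] by (simp only:)
next
  case (Suc k)
  then obtain z where z: "\<And>g. g \<in> S \<Longrightarrow> z g \<in> carrier N" "\<And>g l. \<lbrakk>g \<in> S; l < k\<rbrakk> \<Longrightarrow> z g l = \<zero>\<^bsub>P l\<^esub>"
    and x: "x = (\<Oplus>\<^bsub>N\<^esub>g\<in>S. g \<odot>\<^bsub>N\<^esub> z g)"
    using component_zero_imp_combination[of x k] by blast
  interpret H: subgroup "smult_span N (pw (Suc k))" "add_monoid N"
    by (rule N.subgroup_smult_span[OF pw_carrier])
  have gz: "g \<odot>\<^bsub>N\<^esub> z g \<in> smult_span N (pw (Suc k))" if g: "g \<in> S" for g
  proof -
    have "g \<in> I" unfolding gens(3) using A.genideal_self[OF gens(2)] g by blast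
    then show ?thesis
      unfolding pw_Suc by (rule N.smult_smult_span[OF ideal_pw ideal_I _ Suc.IH[OF z(1)[OF g] z(2)[OF g]]])
  qed
  have sub: "smult_span N (pw (Suc k)) \<subseteq> carrier N" using H.subset by simp
  have "F \<subseteq> S \<Longrightarrow> (\<Oplus>\<^bsub>N\<^esub>g\<in>F. g \<odot>\<^bsub>N\<^esub> z g) \<in> smult_span N (pw (Suc k))" if "finite F" for F
    using that
  proof (induction F)
    case empty then show ?case using H.one_closed by simp
  next
    case (insert g F)
    then have "(\<Oplus>\<^bsub>N\<^esub>g\<in>insert g F. g \<odot>\<^bsub>N\<^esub> z g) = g \<odot>\<^bsub>N\<^esub> z g \<oplus>\<^bsub>N\<^esub> (\<Oplus>\<^bsub>N\<^esub>g\<in>F. g \<odot>\<^bsub>N\<^esub> z g)"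
      using gz sub by (intro N.M.finsum_insert) auto
    then show ?case using insert gz H.m_closed by simp
  qed
  from this[OF gens(1) subset_refl] show ?case by (simp add: x)
qed

lemma smult_span_iff_component_zero:
  assumes "x \<in> carrier N"
  shows "x \<in> smult_span N (pw (Suc k)) \<longleftrightarrow> x k = \<zero>\<^bsub>P k\<^esub>"
  using assms smult_span_imp_component_zero components_zero_imp_smult_span[of x "Suc k"]
    component_zero[of x k] by (metis less_Suc_eq_le)

end

section \<open>The quotients by the powers of an ideal\<close>

context adic_ideal
begin

abbreviation Q :: "nat \<Rightarrow> 'a set ring" where "Q \<equiv> adic_ring A I"
abbreviation q :: "nat \<Rightarrow> 'a \<Rightarrow> 'a set" where "q \<equiv> adic_proj A I"
abbreviation t :: "nat \<Rightarrow> 'a set \<Rightarrow> 'a set" where "t \<equiv> adic_trans A I"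

lemma ideal_adic_power: "ideal (adic_power A I k) A"
  unfolding adic_power_def by (rule ideal_pw)

lemma cring_Q: "cring (Q k)"
  unfolding adic_ring_def by (rule ideal.quotient_is_cring[OF ideal_adic_power cring_A])

sublocale Q: cring "Q k" for k by (rule cring_Q)

lemma q_hom: "q k \<in> ring_hom A (Q k)"
  using ideal.rcos_ring_hom[OF ideal_adic_power, of k] unfolding adic_ring_def adic_proj_def .

lemma q_surj: "q k ` carrier A = carrier (Q k)"
  by (auto simp: adic_ring_def adic_proj_def FactRing_def A_RCOSETS_def' a_r_coset_def')

lemma q_eq_iff:
  "\<lbrakk>a \<in> carrier A; b \<in> carrier A\<rbrakk> \<Longrightarrow> q k a = q k b \<longleftrightarrow> a \<ominus>\<^bsub>A\<^esub> b \<in> adic_power A I k"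
  unfolding adic_proj_def by (rule A.quotient_eq_iff_same_a_r_cos[OF ideal_adic_power, symmetric])

lemma q_zero: "q k \<zero>\<^bsub>A\<^esub> = \<zero>\<^bsub>Q k\<^esub>"
  by (rule ring_hom_zero[OF q_hom A.ring_axioms Q.ring_axioms])

lemma q_eq_zero_iff: "a \<in> carrier A \<Longrightarrow> q k a = \<zero>\<^bsub>Q k\<^esub> \<longleftrightarrow> a \<in> adic_power A I k"
  using q_eq_iff[of a "\<zero>\<^bsub>A\<^esub>" k] by (simp add: q_zero a_minus_def)

lemma kernel_q: "a_kernel A (Q k) (q k) = adic_power A I k"
  unfolding a_kernel_def' using q_eq_zero_iff ideal.Icarr[OF ideal_adic_power] by blast

lemma adic_power_Suc_subset: "adic_power A I (Suc k) \<subseteq> adic_power A I k"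
  unfolding adic_power_def by (rule pw_antimono) simp

lemma t_q:
  assumes a: "a \<in> carrier A" shows "t k (q (Suc k) a) = q k a"
proof -
  interpret J: ideal "adic_power A I (Suc k)" A by (rule ideal_adic_power)
  have self: "a \<in> q (Suc k) a"
    using J.a_rcos_self[OF a] by (simp add: adic_proj_def)
  have "q k b = q k a" if b: "b \<in> q (Suc k) a" for b
  proof -
    have "q (Suc k) a = q (Suc k) b"
      using b a J.a_subgroup unfolding adic_proj_def by (rule A.a_repr_independence)
    moreover have bA: "b \<in> carrier A"
      using b A.a_r_coset_subset_G[OF J.a_subset a] unfolding adic_proj_def by blast
    ultimately show ?thesis
      using a q_eq_iff[of b a] adic_power_Suc_subset by (metis subsetD)
  qed
  then have "q k ` q (Suc k) a = {q k a}" using self by blast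
  then show ?thesis by (simp add: adic_trans_def coset_lift_def)
qed

lemma Q_cases:
  assumes "s \<in> carrier (Q k)" obtains a where "a \<in> carrier A" "s = q k a"
  using assms q_surj by blast

lemma t_hom: "t k \<in> ring_hom (Q (Suc k)) (Q k)"
proof (rule ring_hom_memI)
  fix x assume "x \<in> carrier (Q (Suc k))"
  then show "t k x \<in> carrier (Q k)"
    by (elim Q_cases) (simp add: t_q ring_hom_closed[OF q_hom])
next
  fix x y assume "x \<in> carrier (Q (Suc k))" "y \<in> carrier (Q (Suc k))"
  then obtain a b where ab: "a \<in> carrier A" "x = q (Suc k) a" "b \<in> carrier A" "y = q (Suc k) b"
    by (metis Q_cases)
  show "t k (x \<otimes>\<^bsub>Q (Suc k)\<^esub> y) = t k x \<otimes>\<^bsub>Q k\<^esub> t k y"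
    using ab by (simp add: t_q ring_hom_mult[OF q_hom, symmetric])
  show "t k (x \<oplus>\<^bsub>Q (Suc k)\<^esub> y) = t k x \<oplus>\<^bsub>Q k\<^esub> t k y"
    using ab by (simp add: t_q ring_hom_add[OF q_hom, symmetric])
next
  show "t k \<one>\<^bsub>Q (Suc k)\<^esub> = \<one>\<^bsub>Q k\<^esub>"
    using t_q[of "\<one>\<^bsub>A\<^esub>"] by (simp add: ring_hom_one[OF q_hom])
qed

lemma t_surj: "t k ` carrier (Q (Suc k)) = carrier (Q k)"
  by (simp add: q_surj[symmetric] image_image t_q)

lemma base_change_q: "module A N \<Longrightarrow> surjective_base_change A (Q k) (q k) N"
  by (rule surjective_base_change.intro[OF cring_A cring_Q q_hom q_surj])

lemma base_change_t: "module (Q (Suc k)) N \<Longrightarrow> surjective_base_change (Q (Suc k)) (Q k) (t k) N"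
  by (rule surjective_base_change.intro[OF cring_Q cring_Q t_hom t_surj])

lemma restrict_smult: "a \<odot>\<^bsub>restrict_scalars (q k) M\<^esub> x = q k a \<odot>\<^bsub>M\<^esub> x"
  by (simp add: restrict_scalars_def)

text \<open>The kernel of \<open>A/I\<^sup>k\<^sup>+\<^sup>2 \<rightarrow> A/I\<^sup>k\<^sup>+\<^sup>1\<close> is the image of \<open>I\<^sup>k\<^sup>+\<^sup>1\<close>. This transports the kernel of a transition from
modules over \<open>A/I\<^sup>k\<^sup>+\<^sup>2\<close> to modules over \<^term>\<open>A\<close>.\<close>

lemma smult_span_kernel_t:
  assumes M: "module (Q (Suc k)) M"
  shows "smult_span M (a_kernel (Q (Suc k)) (Q k) (t k))
    \<subseteq> smult_span (restrict_scalars (q (Suc k)) M) (adic_power A I k)"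
proof -
  let ?M = "restrict_scalars (q (Suc k)) M"
  interpret M: module "Q (Suc k)" M by (rule M)
  interpret RM: module A ?M by (rule module_restrict_scalars[OF cring_A q_hom M])
  have "subgroup (smult_span ?M (adic_power A I k)) (add_monoid ?M)"
    by (rule RM.subgroup_smult_span) (use ideal.Icarr[OF ideal_adic_power] in blast)
  then have "subgroup (smult_span ?M (adic_power A I k)) (add_monoid M)"
    unfolding subgroup_def by (simp add: restrict_scalars_def m_inv_def)
  then show ?thesis
  proof (rule M.smult_span_subset_subgroup)
    fix r x assume r: "r \<in> a_kernel (Q (Suc k)) (Q k) (t k)" and x: "x \<in> carrier M"
    then have "r \<in> carrier (Q (Suc k))" "t k r = \<zero>\<^bsub>Q k\<^esub>" by (auto simp: a_kernel_def')
    then obtain a where a: "a \<in> carrier A" "r = q (Suc k) a" "a \<in> adic_power A I k"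
      by (metis Q_cases t_q q_eq_zero_iff)
    have "a \<odot>\<^bsub>?M\<^esub> x \<in> smult_span ?M (adic_power A I k)"
      by (rule smult_span_incl[OF a(3)]) (simp add: restrict_scalars_def x)
    then show "r \<odot>\<^bsub>M\<^esub> x \<in> smult_span ?M (adic_power A I k)"
      by (simp add: a(2) restrict_smult)
  qed
qed

text \<open>In terms of the elements \<open>1 \<otimes> n\<close>, the transitions of the completion are the quotient maps
\<open>N / I\<^sup>k\<^sup>+\<^sup>2 N \<rightarrow> N / I\<^sup>k\<^sup>+\<^sup>1 N\<close>.\<close>

lemma reduction_transition:
  assumes N: "module A N" and n: "n \<in> carrier N"
  shows "tensor_lift (adic_reduction A I N k)
      (\<lambda>s n. pure_tensor A (adic_algebra A I k) N (t k s) n)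
      (pure_tensor A (adic_algebra A I (Suc k)) N \<one>\<^bsub>Q (Suc k)\<^esub> n)
    = pure_tensor A (adic_algebra A I k) N \<one>\<^bsub>Q k\<^esub> n"
proof -
  interpret k: surjective_base_change A "Q k" "q k" N by (rule base_change_q[OF N])
  interpret k': surjective_base_change A "Q (Suc k)" "q (Suc k)" N by (rule base_change_q[OF N])
  note t = ring_hom_closed[OF t_hom] ring_hom_add[OF t_hom] ring_hom_mult[OF t_hom] ring_hom_one[OF t_hom]
  have "balanced_mod A k'.B N k.T {\<zero>\<^bsub>k.T\<^esub>} (\<lambda>s n. pure_tensor A k.B N (t k s) n)"
    unfolding balanced_mod_def
  proof (intro conjI ballI)
    fix m n assume "m \<in> carrier k'.B" "n \<in> carrier N"
    then show "pure_tensor A k.B N (t k m) n \<in> carrier k.T" by (simp add: pure_tensor_closed t)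
  next
    fix m m' n assume el: "m \<in> carrier k'.B" "m' \<in> carrier k'.B" "n \<in> carrier N"
    then have "pure_tensor A k.B N (t k (m \<oplus>\<^bsub>k'.B\<^esub> m')) n
        = pure_tensor A k.B N (t k m) n \<oplus>\<^bsub>k.T\<^esub> pure_tensor A k.B N (t k m') n"
      using pure_tensor_add_left[OF k.module_B N, of "t k m" "t k m'" n] by (simp add: t)
    then show "pure_tensor A k.B N (t k (m \<oplus>\<^bsub>k'.B\<^esub> m')) n
        \<ominus>\<^bsub>k.T\<^esub> pure_tensor A k.B N (t k m) n \<ominus>\<^bsub>k.T\<^esub> pure_tensor A k.B N (t k m') n \<in> {\<zero>\<^bsub>k.T\<^esub>}"
      using el by (simp add: pure_tensor_closed t k.T.minus_cancel)
  next
    fix m n n' assume el: "m \<in> carrier k'.B" "n \<in> carrier N" "n' \<in> carrier N"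
    then have "pure_tensor A k.B N (t k m) (n \<oplus>\<^bsub>N\<^esub> n')
        = pure_tensor A k.B N (t k m) n \<oplus>\<^bsub>k.T\<^esub> pure_tensor A k.B N (t k m) n'"
      using pure_tensor_add_right[OF k.module_B N, of "t k m" n n'] by (simp add: t)
    then show "pure_tensor A k.B N (t k m) (n \<oplus>\<^bsub>N\<^esub> n')
        \<ominus>\<^bsub>k.T\<^esub> pure_tensor A k.B N (t k m) n \<ominus>\<^bsub>k.T\<^esub> pure_tensor A k.B N (t k m) n' \<in> {\<zero>\<^bsub>k.T\<^esub>}"
      using el by (simp add: pure_tensor_closed t k.T.minus_cancel)
  next
    fix r m n assume el: "r \<in> carrier A" "m \<in> carrier k'.B" "n \<in> carrier N"
    then have "pure_tensor A k.B N (t k (r \<odot>\<^bsub>k'.B\<^esub> m)) n = pure_tensor A k.B N (t k m) (r \<odot>\<^bsub>N\<^esub> n)"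
      using pure_tensor_balanced[OF k.module_B N, of r "t k m" n] by (simp add: t t_q)
    then show "pure_tensor A k.B N (t k (r \<odot>\<^bsub>k'.B\<^esub> m)) n
        \<ominus>\<^bsub>k.T\<^esub> pure_tensor A k.B N (t k m) (r \<odot>\<^bsub>N\<^esub> n) \<in> {\<zero>\<^bsub>k.T\<^esub>}"
      using el by (simp add: pure_tensor_closed t)
  qed
  from tensor_lift_pure_tensor[OF k'.module_B N k.abelian_group_T this, of "\<one>\<^bsub>Q (Suc k)\<^esub>" n] n
  show ?thesis by (simp add: adic_algebra_def t)
qed

text \<open>The elements of the completion are the compatible sequences in the quotients \<open>N / I\<^sup>k\<^sup>+\<^sup>1 N\<close>; representatives of
such a sequence form a Cauchy sequence in \<open>N\<close>. So completeness follows from separatedness and from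
convergence of Cauchy sequences that progress by one power of \<^term>\<open>I\<close> in each step.\<close>

lemma adically_completeI:
  assumes N: "module A N"
    and sep: "\<And>x. \<lbrakk>x \<in> carrier N; \<And>k. x \<in> smult_span N (adic_power A I k)\<rbrakk> \<Longrightarrow> x = \<zero>\<^bsub>N\<^esub>"
    and lim: "\<And>n :: nat \<Rightarrow> 'n. \<lbrakk>\<And>k. n k \<in> carrier N;
        \<And>k. n (Suc k) \<ominus>\<^bsub>N\<^esub> n k \<in> smult_span N (adic_power A I k)\<rbrakk>
      \<Longrightarrow> \<exists>x\<in>carrier N. \<forall>k. x \<ominus>\<^bsub>N\<^esub> n k \<in> smult_span N (adic_power A I k)"
  shows "adically_complete A I N"
proof -
  interpret N: module A N by (rule N)
  interpret R: surjective_base_change A "Q k" "q k" N for k by (rule base_change_q[OF N])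
  define u where "u k n = pure_tensor A (adic_algebra A I k) N \<one>\<^bsub>Q k\<^esub> n" for k n
  define \<theta> where "\<theta> k = tensor_lift (adic_reduction A I N k)
      (\<lambda>s n. pure_tensor A (adic_algebra A I k) N (t k s) n)" for k
  have tau: "adic_tau A I N n = (\<lambda>k. u k n)" for n by (simp add: adic_tau_def u_def)
  have compl: "adic_completion A I N = inverse_limit (adic_reduction A I N) \<theta>"
    unfolding adic_completion_def \<theta>_def ..
  have \<theta>u: "\<theta> k (u (Suc k) n) = u k n" if "n \<in> carrier N" for k n
    unfolding \<theta>_def u_def by (rule reduction_transition[OF N that])
  have u_closed: "u k n \<in> carrier (adic_reduction A I N k)" if "n \<in> carrier N" for k n
    using R.unit_tensor_closed[OF that] by (simp add: u_def adic_algebra_def)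
  have u_add: "u k (n \<oplus>\<^bsub>N\<^esub> n') = u k n \<oplus>\<^bsub>adic_reduction A I N k\<^esub> u k n'"
    if "n \<in> carrier N" "n' \<in> carrier N" for k n n'
    using R.unit_tensor_add[OF that] by (simp add: u_def adic_algebra_def)
  have u_smult: "u k (r \<odot>\<^bsub>N\<^esub> n) = r \<odot>\<^bsub>adic_reduction A I N k\<^esub> u k n"
    if "r \<in> carrier A" "n \<in> carrier N" for k r n
    using R.unit_tensor_smult[OF that] by (simp add: u_def adic_algebra_def)
  have u_eq_iff: "u k n = u k n' \<longleftrightarrow> n \<ominus>\<^bsub>N\<^esub> n' \<in> smult_span N (adic_power A I k)"
    if "n \<in> carrier N" "n' \<in> carrier N" for k n n'
    using R.unit_tensor_eq_iff[OF that] by (simp add: u_def adic_algebra_def kernel_q)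
  have u_surj: "carrier (adic_reduction A I N k) = u k ` carrier N" for k
    using R.carrier_T[of k] by (simp add: u_def adic_algebra_def)
  have "adic_tau A I N \<in> module_hom A N (adic_completion A I N)"
    unfolding module_hom_def compl
    by (auto simp: tau inverse_limit_simps u_closed u_add u_smult \<theta>u)
  moreover have "inj_on (adic_tau A I N) (carrier N)"
  proof (rule inj_onI)
    fix x y assume xy: "x \<in> carrier N" "y \<in> carrier N" "adic_tau A I N x = adic_tau A I N y"
    then have "u k x = u k y" for k unfolding tau by metis
    then have "x \<ominus>\<^bsub>N\<^esub> y \<in> smult_span N (adic_power A I k)" for k using u_eq_iff xy by blast
    then have "x \<ominus>\<^bsub>N\<^esub> y = \<zero>\<^bsub>N\<^esub>" using sep xy by simp
    then show "x = y" using N.M.minus_eq_zero_iff xy by blast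
  qed
  moreover have "carrier (adic_completion A I N) \<subseteq> adic_tau A I N ` carrier N"
  proof
    fix y assume "y \<in> carrier (adic_completion A I N)"
    then have y: "y k \<in> u k ` carrier N" "\<theta> k (y (Suc k)) = y k" for k
      by (simp_all add: compl inverse_limit_simps u_surj)
    have "\<forall>k. \<exists>n. n \<in> carrier N \<and> y k = u k n" using y(1) by blast
    then obtain n where n: "\<And>k. n k \<in> carrier N" "\<And>k. y k = u k (n k)" by metis
    have "u k (n (Suc k)) = u k (n k)" for k using y(2)[of k] n \<theta>u by simp
    then have "n (Suc k) \<ominus>\<^bsub>N\<^esub> n k \<in> smult_span N (adic_power A I k)" for k
      using u_eq_iff n(1) by blast
    from lim[OF n(1) this] obtain x where
      x: "x \<in> carrier N" "\<And>k. x \<ominus>\<^bsub>N\<^esub> n k \<in> smult_span N (adic_power A I k)" by blast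
    then have "y = adic_tau A I N x" unfolding tau using n u_eq_iff by (simp add: fun_eq_iff) metis
    then show "y \<in> adic_tau A I N ` carrier N" using x(1) by blast
  qed
  ultimately have "adic_tau A I N \<in> module_iso A N (adic_completion A I N)"
    unfolding module_iso_def bij_betw_def module_hom_def by blast
  then show ?thesis unfolding adically_complete_def using N by blast
qed

end

section \<open>Adic systems\<close>

context adic_tower
begin

text \<open>Elements of \<open>N\<close> are congruent modulo \<open>I\<^sup>k\<^sup>+\<^sup>1 N\<close> exactly if their components at \<open>k\<close> agree. So
the limit of a Cauchy sequence \<open>n\<close> is its diagonal \<open>k \<mapsto> n k k\<close>.\<close>

lemma adically_complete_N: "adically_complete A I N"
proof (rule adically_completeI[OF module_N])
  note span = smult_span_iff_component_zero[folded adic_power_def]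
  fix x assume x: "x \<in> carrier N" and "\<And>k. x \<in> smult_span N (adic_power A I k)"
  then have "x k = \<zero>\<^bsub>P k\<^esub>" for k using span by blast
  then show "x = \<zero>\<^bsub>N\<^esub>" by (simp add: fun_eq_iff inverse_limit_simps(2))
next
  note span = smult_span_iff_component_zero[folded adic_power_def]
  have diff: "x \<ominus>\<^bsub>N\<^esub> y \<in> smult_span N (adic_power A I k) \<longleftrightarrow> x k = y k"
    if xy: "x \<in> carrier N" "y \<in> carrier N" for x y k
  proof -
    have "(x \<ominus>\<^bsub>N\<^esub> y) k = x k \<ominus>\<^bsub>P k\<^esub> y k" by (rule module_hom_minus[OF module_N P proj_hom xy])
    then show ?thesis
      using span[of "x \<ominus>\<^bsub>N\<^esub> y" k] xy P.M.minus_eq_zero_iff[OF N_D(1)[OF xy(1)] N_D(1)[OF xy(2)]] by simp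
  qed
  fix n assume n: "\<And>k. n k \<in> carrier N"
    and "\<And>k. n (Suc k) \<ominus>\<^bsub>N\<^esub> n k \<in> smult_span N (adic_power A I k)"
  then have step: "n (Suc k) k = n k k" for k using diff by blast
  let ?x = "\<lambda>k. n k k"
  have x: "?x \<in> carrier N"
    unfolding inverse_limit_simps using N_D[OF n] step by metis
  have "?x \<ominus>\<^bsub>N\<^esub> n k \<in> smult_span N (adic_power A I k)" for k using diff[OF x n] by blast
  then show "\<exists>x\<in>carrier N. \<forall>k. x \<ominus>\<^bsub>N\<^esub> n k \<in> smult_span N (adic_power A I k)" using x by blast
qed

end

text \<open>The transitions are linear over \<open>A/I\<^sup>k\<^sup>+\<^sup>2\<close> because the projection from \<^term>\<open>A\<close> is surjective; so the
criterion for bijectivity of a base change applies to them.\<close>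

lemma adic_system_imp_tower:
  assumes A: "cring A" and I: "ideal I A" and S: "finite S" "S \<subseteq> carrier A" "I = Idl\<^bsub>A\<^esub> S"
    and sys: "adic_system A I M \<nu>"
  shows "adic_tower A I S (\<lambda>k. restrict_scalars (adic_proj A I k) (M k)) \<nu>"
proof -
  interpret adic_ideal A I by (rule adic_ideal.intro[OF A I])
  let ?P = "\<lambda>k. restrict_scalars (q k) (M k)"
  have M: "module (Q k) (M k)" and \<nu>: "\<nu> k \<in> module_hom A (?P (Suc k)) (?P k)"
    and bij: "bij_betw (base_change_lift (M k) (\<nu> k))
           (carrier (tensor (Q (Suc k)) (restrict_scalars (t k) (self_module (Q k))) (M (Suc k))))
           (carrier (M k))" for k
    using sys unfolding adic_system_def by blast+
  have P: "module A (?P k)" for k by (rule module_restrict_scalars[OF A q_hom M])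
  have carrier_P: "carrier (?P k) = carrier (M k)" "\<zero>\<^bsub>?P k\<^esub> = \<zero>\<^bsub>M k\<^esub>"
    "ring.add (?P k) = ring.add (M k)" for k
    by (simp_all add: restrict_scalars_def)
  have \<nu>_Q: "\<nu> k \<in> module_hom (Q (Suc k)) (M (Suc k)) (restrict_scalars (t k) (M k))" for k
  proof -
    have "\<nu> k (r \<odot>\<^bsub>M (Suc k)\<^esub> x) = t k r \<odot>\<^bsub>M k\<^esub> \<nu> k x"
      if "r \<in> carrier (Q (Suc k))" and x: "x \<in> carrier (M (Suc k))" for r x
    proof -
      obtain a where a: "a \<in> carrier A" "r = q (Suc k) a" using \<open>r \<in> carrier (Q (Suc k))\<close> by (rule Q_cases)
      then show ?thesis
        using module_homD(3)[OF \<nu>, of a x k] x by (simp add: t_q restrict_smult carrier_P)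
    qed
    then show ?thesis
      using module_homD(1,2)[OF \<nu>] by (auto simp: module_hom_def restrict_scalars_def)
  qed
  have iff: "\<nu> k ` carrier (M (Suc k)) = carrier (M k) \<and> (\<forall>n\<in>carrier (M (Suc k)). \<nu> k n = \<zero>\<^bsub>M k\<^esub> \<longrightarrow>
      n \<in> smult_span (M (Suc k)) (a_kernel (Q (Suc k)) (Q k) (t k)))" for k
    using surjective_base_change.bij_betw_base_change_lift_iff[OF base_change_t[OF M] M \<nu>_Q] bij by blast
  show ?thesis
  proof (intro adic_tower.intro adic_tower_axioms.intro adic_ideal_axioms S P \<nu>)
    show "\<nu> k ` carrier (?P (Suc k)) = carrier (?P k)" for k using iff by (simp add: carrier_P)
    show "x \<in> smult_span (?P (Suc k)) (pw (Suc k))" if "x \<in> carrier (?P (Suc k))" "\<nu> k x = \<zero>\<^bsub>?P k\<^esub>" for k x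
      using iff[of k] that smult_span_kernel_t[OF M, of k] by (auto simp: carrier_P adic_power_def)
    show "a \<odot>\<^bsub>?P k\<^esub> x = \<zero>\<^bsub>?P k\<^esub>" if a: "a \<in> pw (Suc k)" and x: "x \<in> carrier (?P k)" for k a x
    proof -
      interpret M: module "Q k" "M k" by (rule M)
      have "q k a = \<zero>\<^bsub>Q k\<^esub>"
        using a pw_carrier q_eq_zero_iff[of a k] unfolding adic_power_def by blast
      then show ?thesis using x by (simp add: restrict_smult carrier_P)
    qed
  qed
qed

theorem theorem0p2:
  fixes A :: "('a, 'x) ring_scheme"
    and I :: "'a set"
    and M :: "nat \<Rightarrow> ('a set, 'm, 'y) module_scheme"
    and \<nu> :: "nat \<Rightarrow> 'm \<Rightarrow> 'm"
  assumes "cring A"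
    and "ideal I A"
    and "\<exists>S. finite S \<and> S \<subseteq> carrier A \<and> I = Idl\<^bsub>A\<^esub> S"
    and "adic_system A I M \<nu>"
  shows "adically_complete A I (adic_limit A I M \<nu>) \<and>
    (\<forall>k. bij_betw (base_change_lift (M k) (\<lambda>x. x k))
           (carrier (tensor A (adic_algebra A I k) (adic_limit A I M \<nu>)))
           (carrier (M k)))"
proof -
  obtain S where S: "finite S" "S \<subseteq> carrier A" "I = Idl\<^bsub>A\<^esub> S" using assms(3) by blast
  let ?P = "\<lambda>k. restrict_scalars (adic_proj A I k) (M k)"
  interpret adic_tower A I S ?P \<nu>
    by (rule adic_system_imp_tower[OF assms(1,2) S assms(4)])
  have M: "module (Q k) (M k)" for k using assms(4) unfolding adic_system_def by blast
  have N: "adic_limit A I M \<nu> = N" by (simp add: adic_limit_def)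
  have "bij_betw (base_change_lift (M k) (\<lambda>x. x k)) (carrier (tensor A (adic_algebra A I k) N)) (carrier (M k))" for k
  proof -
    interpret R: surjective_base_change A "Q k" "q k" N by (rule base_change_q[OF module_N])
    have carrier_P: "carrier (?P k) = carrier (M k)" "\<zero>\<^bsub>?P k\<^esub> = \<zero>\<^bsub>M k\<^esub>"
      by (simp_all add: restrict_scalars_def)
    have "(\<lambda>x. x k) ` carrier N = carrier (M k)"
      using proj_surj[of _ k] N_D(1)[of _ k] unfolding carrier_P by blast
    moreover have "\<forall>x\<in>carrier N. x k = \<zero>\<^bsub>M k\<^esub> \<longrightarrow> x \<in> smult_span N R.J"
      using smult_span_iff_component_zero[of _ k] unfolding carrier_P kernel_q adic_power_def by blast
    ultimately show ?thesis
      using R.bij_betw_base_change_lift_iff[OF M proj_hom] unfolding adic_algebra_def by blast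
  qed
  then show ?thesis unfolding N using adically_complete_N by blast
qed

end
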